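(* Let $\mathcal X$ be a Banach space with norm $\|\cdot\|$, let $\rho:\mathcal X\to[0,\infty]$ be a measurable functional such that (i) $\rho(ax)=|a|\rho(x)$ for all $a\in\mathbb R$, $x\in\mathcal X$, and (ii) $B_{0}:=\{x\in\mathcal X:\rho(x)\le 1\}\subseteq\{x\in\mathcal X:\|x\|\le 1\}$. For each integer $\ell\ge 0$ let $\bar N_\ell=N_{3^{-(\ell+1)}}(B_{0})$ be the $3^{-(\ell+1)}$-covering number of $B_{0}$. Let $q>p\ge 1$, let $\mu$ be a probability measure on $\mathcal X$ such that for $X\sim\mu$ one has $\left(\mathbb E[\rho(X)^q]\right)^{1/q}=M_q<\infty$, and let $\hat\mu$ be the empirical measure of $n$ independent samples from $\mu$. Then there is a constant $c_{p,q}$ depending only on $(p,q)$ such that, for any $\ell^*\in\mathbb N$, $$\mathbb E\, W_p^p(\hat\mu,\mu)\le c_{p,q}M_q^p\sum_{j\ge 0}2^{pj}\left\{2^{-qj}3^{-p\ell^*}+\sum_{\ell=0}^{\ell^*}3^{-p\ell}\left[2^{-qj}\wedge\left(\bar N_\ell\, 2^{-qj}n^{-1}\right)^{1/2}\right]\right\}.$$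
   Context: $\mathbb N$ is the set of positive integers and $a\wedge b=\min(a,b)$. For probability measures $\mu,\nu$ on $\mathcal X$ and $p\in[1,\infty)$, $W_p(\mu,\nu)=\inf_{\xi\in\mathcal C(\mu,\nu)}\left[\mathbb E_{(X,Y)\sim\xi}\|X-Y\|^p\right]^{1/p}$, where $\mathcal C(\mu,\nu)$ is the set of all distributions on $\mathcal X^2$ with marginals $\mu$ and $\nu$; $W_p^p$ denotes its $p$-th power. The empirical measure $\hat\mu$ puts mass $1/n$ at each of $n$ independent samples from $\mu$; the expectation $\mathbb E$ is over these samples. For $B\subseteq\mathcal X$ and $\epsilon\in(0,1]$, the $\epsilon$-covering number is $N_\epsilon(B)=\inf\{N\in\mathbb N:\exists\,x_1,\dots,x_N\in B\text{ such that }B\subseteq\bigcup_{i=1}^N\{y\in\mathcal X:\|y-x_i\|\le\epsilon\}\}$ (equal to $+\infty$ if no such $N$ exists). Homogeneity of $\rho$ uses the convention $0\cdot\infty=0$. *)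

theory Defs
  imports "HOL-Probability.Probability"
begin

text \<open>Real powers of extended nonnegative numbers, used only for exponents \<open>a > 0\<close>
  (so \<open>0\<close> goes to \<open>0\<close> and \<open>\<infinity>\<close> to \<open>\<infinity>\<close>).\<close>

definition epowr :: "ennreal \<Rightarrow> real \<Rightarrow> ennreal" (infixr "epowr" 80) where
  "x epowr a = (if x = \<infinity> then \<infinity> else ennreal (enn2real x powr a))"

text \<open>Couplings are Borel measures on the topological product \<open>'a \<times> 'a\<close>. The product
  sigma-algebra \<open>borel \<Otimes>\<^sub>M borel\<close> is the same if \<open>'a\<close> is separable; otherwise it can be smaller,
  and \<open>\<lambda>(x, y). norm (x - y)\<close> need not be measurable for it.\<close>

definition couplings ::
    "'a::topological_space measure \<Rightarrow> 'a measure \<Rightarrow> ('a \<times> 'a) measure set" where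
  "couplings \<mu> \<nu> = {\<xi>. prob_space \<xi> \<and> sets \<xi> = sets borel \<and>
     distr \<xi> borel fst = \<mu> \<and> distr \<xi> borel snd = \<nu>}"

definition wasserstein ::
    "real \<Rightarrow> 'a::real_normed_vector measure \<Rightarrow> 'a measure \<Rightarrow> ennreal" where
  "wasserstein p \<mu> \<nu> =
     (INF \<xi>\<in>couplings \<mu> \<nu>. (\<integral>\<^sup>+z. ennreal (norm (fst z - snd z) powr p) \<partial>\<xi>) epowr (1 / p))"

definition empirical_measure :: "nat \<Rightarrow> (nat \<Rightarrow> 'a::topological_space) \<Rightarrow> 'a measure" where
  "empirical_measure n x = distr (measure_pmf (pmf_of_set {..<n})) borel x"

definition covering_number :: "real \<Rightarrow> 'a::real_normed_vector set \<Rightarrow> enat" where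
  "covering_number \<epsilon> B = Inf {enat N | N. 0 < N \<and>
     (\<exists>x :: nat \<Rightarrow> 'a. (\<forall>i<N. x i \<in> B) \<and> B \<subseteq> (\<Union>i<N. {y. norm (y - x i) \<le> \<epsilon>}))}"

text \<open>The Wasserstein distance to the empirical measure is a measurable function of the samples
  if the space is separable, but possibly not in general. For a non-measurable integrand,
  \<open>nn_integral\<close> is a lower integral, which would weaken an upper bound. The upper
  integral agrees with \<open>nn_integral\<close> on measurable functions and dominates it always.\<close>

definition outer_expectation :: "'b measure \<Rightarrow> ('b \<Rightarrow> ennreal) \<Rightarrow> ennreal" where
  "outer_expectation M f =
     (INF g\<in>{g \<in> borel_measurable M. \<forall>\<omega>\<in>space M. f \<omega> \<le> g \<omega>}. \<integral>\<^sup>+\<omega>. g \<omega> \<partial>M)"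

lemma nn_integral_le_outer_expectation: "(\<integral>\<^sup>+\<omega>. f \<omega> \<partial>M) \<le> outer_expectation M f"
  unfolding outer_expectation_def by (rule INF_greatest) (auto intro: nn_integral_mono)

lemma outer_expectation_eq_nn_integral:
  assumes "f \<in> borel_measurable M"
  shows "outer_expectation M f = (\<integral>\<^sup>+\<omega>. f \<omega> \<partial>M)"
proof (rule antisym)
  show "outer_expectation M f \<le> (\<integral>\<^sup>+\<omega>. f \<omega> \<partial>M)"
    unfolding outer_expectation_def by (rule INF_lower) (use assms in auto)
qed (rule nn_integral_le_outer_expectation)

text \<open>An admissible value of \<open>c\<^bsub>p,q\<^esub>\<close>; no optimality is intended. The constant has to be the same
  for all Banach spaces and all sample spaces, that is, for all types. An existential quantifier
  inside a theorem with type variables would let it depend on these types, so it is given as an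
  explicit function of \<open>p\<close> and \<open>q\<close> alone.\<close>

definition wasserstein_const :: "real \<Rightarrow> real \<Rightarrow> real" where
  "wasserstein_const p q = 100 powr (p + q)"

end

theory Submission
  imports Defs
begin

text \<open>The space is cut into layers on which \<open>\<rho>\<close> is about \<open>2 ^ j * M\<^sub>q\<close>, and each layer, rescaled
  into \<open>B\<^sub>0\<close>, into nested partitions with \<open>N\<^sub>l\<close> cells of diameter at most \<open>3 ^ -l\<close>. Starting from the
  finest partition, as much mass of \<open>\<mu>\<close> as possible is matched with mass of the empirical measure in
  the same cell; the mass left over in a cell is then exactly the positive or negative part of the
  difference of the two measures there, and it is treated at the next coarser level. Mass left
  over at level \<open>l\<close> therefore travels about \<open>2 ^ j * M\<^sub>q * 3 ^ -l\<close>. The differences have expected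
  total size at most \<open>2 * a\<^sub>j\<close> and, by independence and Cauchy-Schwarz, at most
  \<open>sqrt (N\<^sub>l * a\<^sub>j / n)\<close>, where \<open>a\<^sub>j\<close> is the mass of layer \<open>j\<close>, of order \<open>2 ^ (-q * j)\<close> by Markov's inequality.
  Since the empirical measure has finitely many atoms \<open>x\<^sub>i\<close>, a coupling is a family of
  densities \<open>f\<^sub>i\<close> with respect to \<open>\<mu>\<close> that sum to \<open>1\<close>, and no
  product sigma-algebra on the possibly nonseparable space is needed.\<close>

section \<open>Optimal matching of cells\<close>

text \<open>The unmatched parts of the two measures are carried through the recursion as a density
  \<open>g\<close> with respect to \<open>\<mu>\<close> and as weights \<open>w\<close> on the atoms
  \<open>x i\<close>. Cells are given by predicates, so that one notion serves layers, cells of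
  every level and the whole space.\<close>

definition cell_mass :: "'a measure \<Rightarrow> ('a \<Rightarrow> real) \<Rightarrow> ('a \<Rightarrow> bool) \<Rightarrow> real" where
  "cell_mass \<mu> g P = (\<integral>y. (if P y then g y else 0) \<partial>\<mu>)"

definition atom_mass :: "nat \<Rightarrow> (nat \<Rightarrow> 'a) \<Rightarrow> (nat \<Rightarrow> real) \<Rightarrow> ('a \<Rightarrow> bool) \<Rightarrow> real" where
  "atom_mass n x w P = (\<Sum>i<n. if P (x i) then w i else 0)"

lemma cell_mass_nonneg: "(\<And>y. 0 \<le> g y) \<Longrightarrow> 0 \<le> cell_mass \<mu> g P"
  unfolding cell_mass_def by (intro integral_nonneg_AE) auto

lemma atom_mass_nonneg: "(\<And>i. 0 \<le> w i) \<Longrightarrow> 0 \<le> atom_mass n x w P"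
  unfolding atom_mass_def by (intro sum_nonneg) auto

lemma (in finite_measure) integrable_unit_bounded:
  fixes g :: "'a \<Rightarrow> real"
  assumes "g \<in> borel_measurable M" "\<And>y. 0 \<le> g y" "\<And>y. g y \<le> 1"
  shows "integrable M g"
  by (rule integrable_const_bound[where B=1]) (use assms in auto)

text \<open>If masses \<open>a\<close> and \<open>b\<close> are matched as far as possible, the
  share \<open>b / max a b\<close> of \<open>a\<close> is consumed. For \<open>a = b = 0\<close> the
  convention \<open>x / 0 = 0\<close> still gives the right value.\<close>

lemma mult_one_minus_div_max:
  fixes a b :: real
  assumes "0 \<le> a" "0 \<le> b"
  shows "a * (1 - b / max a b) = max 0 (a - b)"
proof (cases "max a b = 0")
  case False
  then have "a \<noteq> 0 \<or> b \<noteq> 0" by auto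
  then show ?thesis using assms by (auto simp: max_def field_simps)
qed (use assms in \<open>auto simp: max_def split: if_splits\<close>)

text \<open>Cells are treated separately and proportionally: the consumed shares of \<open>g\<close>
  and of \<open>w\<close> are constant on a cell, so measurability of \<open>f\<close> reduces to
  that of \<open>g\<close> and of the label. At least one side of each cell is exhausted, which
  makes the leftovers exact positive parts.\<close>

lemma (in finite_measure) greedy_stage:
  fixes g :: "'a \<Rightarrow> real" and w :: "nat \<Rightarrow> real" and T :: "'a \<Rightarrow> 'k"
  assumes T[measurable]: "T \<in> measurable M (count_space UNIV)"
    and g[measurable]: "g \<in> borel_measurable M" and g0: "\<And>y. 0 \<le> g y" and g1: "\<And>y. g y \<le> 1"
    and w0: "\<And>i. 0 \<le> w i"
  obtains f where "\<And>i. f i \<in> borel_measurable M" "\<And>i y. 0 \<le> f i y"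
    "\<And>y. (\<Sum>i<n. f i y) \<le> g y" "\<And>i. (\<integral>y. f i y \<partial>M) \<le> w i"
    "\<And>i y. f i y \<noteq> 0 \<Longrightarrow> T y = T (x i)"
    "\<And>k. cell_mass M (\<lambda>y. g y - (\<Sum>i<n. f i y)) (\<lambda>y. T y = k) =
      max 0 (cell_mass M g (\<lambda>y. T y = k) - atom_mass n x w (\<lambda>y. T y = k))"
    "\<And>k. atom_mass n x (\<lambda>i. w i - (\<integral>y. f i y \<partial>M)) (\<lambda>y. T y = k) =
      max 0 (atom_mass n x w (\<lambda>y. T y = k) - cell_mass M g (\<lambda>y. T y = k))"
proof -
  define G where "G k = cell_mass M g (\<lambda>y. T y = k)" for k
  define W where "W k = atom_mass n x w (\<lambda>y. T y = k)" for k
  have G0: "0 \<le> G k" and W0: "0 \<le> W k" for k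
    unfolding G_def W_def by (auto intro: cell_mass_nonneg atom_mass_nonneg g0 w0)
  \<comment> \<open>product coupling of the common mass \<open>min G W\<close> of each cell, since \<open>min G W / (G * W) = 1 / max G W\<close>;
    empty cells cause no harm as \<open>x / 0 = 0\<close>\<close>
  define f where "f i y = (if T y = T (x i) then w i * g y / max (G (T y)) (W (T y)) else 0)" for i y
  have fm: "f i \<in> borel_measurable M" for i
  proof -
    have [measurable]: "(\<lambda>y. W (T y)) \<in> borel_measurable M" "(\<lambda>y. G (T y)) \<in> borel_measurable M"
      "Measurable.pred M (\<lambda>y. T y = T (x i))"
      by (rule measurable_compose[OF T], simp)+
    show ?thesis unfolding f_def by measurable
  qed
  have f0: "0 \<le> f i y" for i y
    unfolding f_def using w0 g0 G0 W0 by (auto intro!: divide_nonneg_nonneg mult_nonneg_nonneg simp: le_max_iff_disj)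
  have sumf: "(\<Sum>i<n. f i y) = g y * (W (T y) / max (G (T y)) (W (T y)))" for y
  proof -
    have "(\<Sum>i<n. f i y) = (\<Sum>i<n. (if T (x i) = T y then w i else 0) * (g y / max (G (T y)) (W (T y))))"
      unfolding f_def by (intro sum.cong) auto
    also have "\<dots> = W (T y) * (g y / max (G (T y)) (W (T y)))"
      unfolding sum_distrib_right[symmetric] by (simp add: W_def atom_mass_def)
    finally show ?thesis by (simp add: field_simps)
  qed
  have ratio: "b / max a b \<le> 1" if "0 \<le> a" "0 \<le> b" for a b :: real
    using that by (auto simp: divide_le_eq le_max_iff_disj max_def)
  have intf: "(\<integral>y. f i y \<partial>M) = w i * (G (T (x i)) / max (W (T (x i))) (G (T (x i))))" for i
  proof -
    \<comment> \<open>\<open>f i\<close> vanishes off the cell of \<open>x i\<close>, so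
      \<open>T y\<close> in the denominator becomes the constant \<open>T (x i)\<close>.\<close>
    have "(\<integral>y. f i y \<partial>M) = (\<integral>y. (if T y = T (x i) then g y else 0) * (w i / max (G (T (x i))) (W (T (x i)))) \<partial>M)"
      unfolding f_def by (intro Bochner_Integration.integral_cong) auto
    also have "\<dots> = G (T (x i)) * (w i / max (G (T (x i))) (W (T (x i))))"
      unfolding G_def cell_mass_def by simp
    finally show ?thesis by (simp add: max.commute)
  qed
  have gk: "cell_mass M (\<lambda>y. g y - (\<Sum>i<n. f i y)) (\<lambda>y. T y = k) = max 0 (G k - W k)" for k
  proof -
    have "cell_mass M (\<lambda>y. g y - (\<Sum>i<n. f i y)) (\<lambda>y. T y = k)
      = (\<integral>y. (if T y = k then g y else 0) * (1 - W k / max (G k) (W k)) \<partial>M)"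
      unfolding cell_mass_def by (intro Bochner_Integration.integral_cong) (auto simp: sumf algebra_simps)
    also have "\<dots> = G k * (1 - W k / max (G k) (W k))"
      unfolding G_def cell_mass_def by simp
    finally show ?thesis by (simp add: mult_one_minus_div_max[OF G0 W0])
  qed
  have wk: "atom_mass n x (\<lambda>i. w i - (\<integral>y. f i y \<partial>M)) (\<lambda>y. T y = k) = max 0 (W k - G k)" for k
  proof -
    have "atom_mass n x (\<lambda>i. w i - (\<integral>y. f i y \<partial>M)) (\<lambda>y. T y = k)
      = (\<Sum>i<n. (if T (x i) = k then w i else 0) * (1 - G k / max (W k) (G k)))"
      unfolding atom_mass_def intf by (intro sum.cong) (auto simp: algebra_simps)
    also have "\<dots> = W k * (1 - G k / max (W k) (G k))"
      unfolding W_def atom_mass_def by (simp add: sum_distrib_right)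
    finally show ?thesis by (simp add: mult_one_minus_div_max[OF W0 G0])
  qed
  show thesis
  proof (rule that[of f])
    show "(\<Sum>i<n. f i y) \<le> g y" for y
      unfolding sumf using mult_left_mono[OF ratio[OF G0 W0] g0] by simp
    show "(\<integral>y. f i y \<partial>M) \<le> w i" for i
      unfolding intf using mult_left_mono[OF ratio[OF W0 G0] w0] by simp
    show "T y = T (x i)" if "f i y \<noteq> 0" for i y using that unfolding f_def by presburger
  qed (use fm f0 gk wk in \<open>auto simp: G_def W_def\<close>)
qed

section \<open>Sums and integrals split by layer or cell\<close>

lemma suminf_Kronecker:
  fixes h :: "nat \<Rightarrow> ennreal"
  shows "(\<Sum>j. if k = j then h j else 0) = h k"
  using suminf_finite[of "{k}" "\<lambda>j. if k = j then h j else 0"] by auto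

text \<open>Cost factors depend on a point only through its layer. Splitting the integrand by the
  value of \<open>J\<close> turns a cost into a series over layers, the shape of the final bound; it
  is taken in \<open>ennreal\<close> because it may diverge.\<close>

lemma (in finite_measure) nn_integral_by_index:
  fixes g :: "'a \<Rightarrow> real" and c :: "nat \<Rightarrow> real"
  assumes J[measurable]: "J \<in> measurable M (count_space UNIV)"
    and g[measurable]: "g \<in> borel_measurable M" and g0: "\<And>y. 0 \<le> g y" and g1: "\<And>y. g y \<le> 1"
    and c: "\<And>j. 0 \<le> c j"
  shows "(\<integral>\<^sup>+y. ennreal (c (J y) * g y) \<partial>M) = (\<Sum>j. ennreal (c j) * ennreal (cell_mass M g (\<lambda>y. J y = j)))"
proof -
  have "(\<integral>\<^sup>+y. ennreal (c (J y) * g y) \<partial>M)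
      = (\<integral>\<^sup>+y. (\<Sum>j. if J y = j then ennreal (c j * g y) else 0) \<partial>M)"
    by (simp add: suminf_Kronecker)
  also have "\<dots> = (\<Sum>j. \<integral>\<^sup>+y. (if J y = j then ennreal (c j * g y) else 0) \<partial>M)"
    by (rule nn_integral_suminf) measurable
  also have "\<dots> = (\<Sum>j. ennreal (c j) * ennreal (cell_mass M g (\<lambda>y. J y = j)))"
  proof (rule suminf_cong)
    fix j
    have i: "integrable M (\<lambda>y. if J y = j then g y else 0)"
      by (rule integrable_unit_bounded) (use g0 g1 in auto)
    have "(\<integral>\<^sup>+y. (if J y = j then ennreal (c j * g y) else 0) \<partial>M)
      = (\<integral>\<^sup>+y. ennreal (c j) * ennreal (if J y = j then g y else 0) \<partial>M)"
      by (intro nn_integral_cong) (use c g0 in \<open>auto simp: ennreal_mult\<close>)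
    also have "\<dots> = ennreal (c j) * (\<integral>\<^sup>+y. ennreal (if J y = j then g y else 0) \<partial>M)"
      by (rule nn_integral_cmult) measurable
    also have "\<dots> = ennreal (c j) * ennreal (cell_mass M g (\<lambda>y. J y = j))"
      unfolding cell_mass_def by (subst nn_integral_eq_integral[OF i]) (use g0 in auto)
    finally show "(\<integral>\<^sup>+y. (if J y = j then ennreal (c j * g y) else 0) \<partial>M) = ennreal (c j) * ennreal (cell_mass M g (\<lambda>y. J y = j))" .
  qed
  finally show ?thesis .
qed

lemma atom_sum_by_index:
  fixes c :: "nat \<Rightarrow> real"
  assumes w: "\<And>i. 0 \<le> w i" and c: "\<And>j. 0 \<le> c j"
  shows "(\<Sum>i<n. ennreal (c (J (x i)) * w i)) = (\<Sum>j. ennreal (c j) * ennreal (atom_mass n x w (\<lambda>y. J y = j)))"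
proof -
  have "(\<Sum>i<n. ennreal (c (J (x i)) * w i)) = (\<Sum>i<n. \<Sum>j. if J (x i) = j then ennreal (c j * w i) else 0)"
    by (simp add: suminf_Kronecker)
  also have "\<dots> = (\<Sum>j. \<Sum>i<n. if J (x i) = j then ennreal (c j * w i) else 0)"
    by (rule suminf_sum[symmetric]) auto
  also have "\<dots> = (\<Sum>j. ennreal (c j) * ennreal (atom_mass n x w (\<lambda>y. J y = j)))"
  proof (rule suminf_cong)
    fix j
    have "ennreal (atom_mass n x w (\<lambda>y. J y = j)) = (\<Sum>i<n. ennreal (if J (x i) = j then w i else 0))"
      unfolding atom_mass_def using w by (subst sum_ennreal) auto
    then show "(\<Sum>i<n. if J (x i) = j then ennreal (c j * w i) else 0)
      = ennreal (c j) * ennreal (atom_mass n x w (\<lambda>y. J y = j))"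
      using c w by (simp only: sum_distrib_left) (auto simp: ennreal_mult intro!: sum.cong)
  qed
  finally show ?thesis .
qed

lemma (in finite_measure) cell_mass_split:
  fixes g :: "'a \<Rightarrow> real"
  assumes T[measurable]: "T \<in> measurable M (count_space UNIV)" and S: "S \<in> measurable M (count_space UNIV)"
    and g[measurable]: "g \<in> borel_measurable M" and g0: "\<And>y. 0 \<le> g y" and g1: "\<And>y. g y \<le> 1"
    and N: "\<And>y. T y < (N::nat)"
  shows "cell_mass M g (\<lambda>y. S y = j) = (\<Sum>k<N. cell_mass M g (\<lambda>y. S y = j \<and> T y = k))"
proof -
  have [measurable]: "Measurable.pred M (\<lambda>y. S y = j)" by (rule measurable_compose[OF S]) simp
  have "(\<Sum>k<N. cell_mass M g (\<lambda>y. S y = j \<and> T y = k)) =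
    (\<integral>y. (\<Sum>k<N. if S y = j \<and> T y = k then g y else 0) \<partial>M)"
    unfolding cell_mass_def
    by (rule Bochner_Integration.integral_sum[symmetric], rule integrable_unit_bounded) (use g0 g1 in auto)
  also have "\<dots> = cell_mass M g (\<lambda>y. S y = j)"
    unfolding cell_mass_def
  proof (rule Bochner_Integration.integral_cong)
    show "(\<Sum>k<N. if S y = j \<and> T y = k then g y else 0) = (if S y = j then g y else 0)" for y
      using N[of y] by auto
  qed simp
  finally show ?thesis by simp
qed

lemma atom_mass_split:
  assumes N: "\<And>y. T y < (N::nat)"
  shows "atom_mass n x w (\<lambda>y. S y = j) = (\<Sum>k<N. atom_mass n x w (\<lambda>y. S y = j \<and> T y = k))"
proof -
  have "(\<Sum>k<N. atom_mass n x w (\<lambda>y. S y = j \<and> T y = k)) =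
    (\<Sum>i<n. \<Sum>k<N. if S (x i) = j \<and> T (x i) = k then w i else 0)"
    unfolding atom_mass_def by (rule sum.swap)
  also have "\<dots> = atom_mass n x w (\<lambda>y. S y = j)"
    unfolding atom_mass_def
  proof (rule sum.cong)
    show "(\<Sum>k<N. if S (x i) = j \<and> T (x i) = k then w i else 0) = (if S (x i) = j then w i else 0)" for i
      using N[of "x i"] by auto
  qed simp
  finally show ?thesis by simp
qed

text \<open>The predicate \<open>P\<close> keeps its value along the transport \<open>f\<close>, so
  the mass of each \<open>f i\<close> is removed from the density and from the weights on the same
  side of \<open>P\<close> and cancels in the difference. It is applied to the whole space and to
  cells of coarser levels.\<close>

lemma (in finite_measure) mass_difference_invariant:
  fixes g :: "'a \<Rightarrow> real"
  assumes g[measurable]: "g \<in> borel_measurable M" and g1: "\<And>y. g y \<le> 1"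
    and f[measurable]: "\<And>i. f i \<in> borel_measurable M" and f0: "\<And>i y. 0 \<le> f i y"
    and fg: "\<And>y. (\<Sum>i<n. f i y) \<le> g y"
    and P: "Measurable.pred M P" and supp: "\<And>i y. f i y \<noteq> 0 \<Longrightarrow> P y = P (x i)"
  shows "cell_mass M (\<lambda>y. g y - (\<Sum>i<n. f i y)) P - atom_mass n x (\<lambda>i. w i - (\<integral>y. f i y \<partial>M)) P
    = cell_mass M g P - atom_mass n x w P"
proof -
  note P[measurable]
  have g0: "0 \<le> g y" for y using fg[of y] sum_nonneg[of "{..<n}" "\<lambda>i. f i y"] f0 by fastforce
  have fi1: "f i y \<le> 1" if "i < n" for i y
    using member_le_sum[of i "{..<n}" "\<lambda>i. f i y"] that f0 fg[of y] g1[of y] by fastforce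
  have fi: "integrable M (\<lambda>y. if P y then f i y else 0)" if "i < n" for i
    by (rule integrable_unit_bounded) (use f0 fi1[OF that] in auto)
  have gi: "integrable M (\<lambda>y. if P y then g y else 0)"
    by (rule integrable_unit_bounded) (use g0 g1 in auto)
  have "cell_mass M (\<lambda>y. g y - (\<Sum>i<n. f i y)) P
      = (\<integral>y. (if P y then g y else 0) - (\<Sum>i<n. if P y then f i y else 0) \<partial>M)"
    unfolding cell_mass_def by (intro Bochner_Integration.integral_cong) auto
  also have "\<dots> = cell_mass M g P - (\<Sum>i<n. \<integral>y. (if P y then f i y else 0) \<partial>M)"
    unfolding cell_mass_def
    by (subst Bochner_Integration.integral_diff[OF gi])
      (use fi in \<open>auto intro!: Bochner_Integration.integrable_sum simp: Bochner_Integration.integral_sum\<close>)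
  also have "(\<Sum>i<n. \<integral>y. (if P y then f i y else 0) \<partial>M) = (\<Sum>i<n. if P (x i) then (\<integral>y. f i y \<partial>M) else 0)"
  proof (rule sum.cong)
    fix i
    have "(\<integral>y. (if P y then f i y else 0) \<partial>M) = (\<integral>y. (if P (x i) then f i y else 0) \<partial>M)"
      by (intro Bochner_Integration.integral_cong) (use supp in auto)
    then show "(\<integral>y. (if P y then f i y else 0) \<partial>M) = (if P (x i) then (\<integral>y. f i y \<partial>M) else 0)"
      by simp
  qed simp
  finally have *: "cell_mass M (\<lambda>y. g y - (\<Sum>i<n. f i y)) P = cell_mass M g P - (\<Sum>i<n. if P (x i) then (\<integral>y. f i y \<partial>M) else 0)" .
  have "atom_mass n x (\<lambda>i. w i - (\<integral>y. f i y \<partial>M)) P = atom_mass n x w P - (\<Sum>i<n. if P (x i) then (\<integral>y. f i y \<partial>M) else 0)"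
    unfolding atom_mass_def sum_subtractf[symmetric] by (intro sum.cong) auto
  with * show ?thesis by simp
qed

section \<open>Multiscale transport\<close>

text \<open>\<open>J y\<close> is the layer of \<open>y\<close> and \<open>R\<close> its radius; the cells of level \<open>l\<close> are the sets on which both
  \<open>J\<close> and \<open>T l\<close> are constant. The geometry is only required on the set \<open>Y\<close> of full measure, which
  will be the set where \<open>\<rho>\<close> is finite.\<close>

locale multiscale_partition = finite_measure \<mu> for \<mu> :: "'a::real_normed_vector measure" +
  fixes J :: "'a \<Rightarrow> nat" and T :: "nat \<Rightarrow> 'a \<Rightarrow> nat" and N :: "nat \<Rightarrow> nat" and R :: "nat \<Rightarrow> real"
    and Y :: "'a set" and K :: nat and p :: real
  assumes sets_mu: "sets \<mu> = sets borel"
    and J_meas: "J \<in> measurable \<mu> (count_space UNIV)"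
    and T_meas: "\<And>l. l < K \<Longrightarrow> T l \<in> measurable \<mu> (count_space UNIV)"
    and T_less: "\<And>l y. l < K \<Longrightarrow> T l y < N l"
    and T_nested: "\<And>l y z. Suc l < K \<Longrightarrow> J y = J z \<Longrightarrow> T (Suc l) y = T (Suc l) z \<Longrightarrow> T l y = T l z"
    and R_nonneg: "\<And>j. 0 \<le> R j"
    and norm_le: "\<And>y. y \<in> Y \<Longrightarrow> norm y \<le> R (J y)"
    and diam_le: "\<And>l y z. l < K \<Longrightarrow> y \<in> Y \<Longrightarrow> z \<in> Y \<Longrightarrow> J y = J z \<Longrightarrow> T l y = T l z \<Longrightarrow>
      norm (z - y) \<le> R (J y) / 3 ^ l"
    and AE_Y: "AE y in \<mu>. y \<in> Y"
    and p_ge: "1 \<le> p"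
begin

text \<open>This is the l1 distance of the two measures on layer \<open>j\<close> when only the
  masses of the cells of level \<open>l\<close> are seen. Absolute values bound positive and
  negative parts at once, hence the leftovers of both measures.\<close>

definition discrepancy :: "('a \<Rightarrow> real) \<Rightarrow> nat \<Rightarrow> (nat \<Rightarrow> 'a) \<Rightarrow> (nat \<Rightarrow> real) \<Rightarrow> nat \<Rightarrow> nat \<Rightarrow> real" where
  "discrepancy g n x w l j = (\<Sum>k<N l. \<bar>cell_mass \<mu> g (\<lambda>y. J y = j \<and> T l y = k)
     - atom_mass n x w (\<lambda>y. J y = j \<and> T l y = k)\<bar>)"

text \<open>Mass left over at level \<open>l\<close> moves within a cell of level \<open>l - 1\<close>, which costs a factor \<open>3 powr p\<close>;
  at level \<open>0\<close> it moves across layers, which costs \<open>2 * 2 powr p\<close>. The constant \<open>4 powr p\<close> covers both.\<close>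

definition scale_weight :: "nat \<Rightarrow> real" where
  "scale_weight l = 4 powr p * 3 powr (- p * real l)"

lemma T_nested':
  assumes "l \<le> m" "m < K" "J y = J z" "T m y = T m z"
  shows "T l y = T l z"
  using assms by (induction m rule: dec_induct) (auto intro: T_nested)

text \<open>The mass that no level could match is moved by the product of the two remaining
  measures, divided by their common mass \<open>m\<close>. Since
  \<open>norm (x i - y) powr p\<close> is at most a term in the layer of \<open>x i\<close> plus a
  term in the layer of \<open>y\<close>, only the marginals enter the cost, and each has mass at
  most \<open>B j\<close> in layer \<open>j\<close>.\<close>

lemma product_transport:
  assumes g[measurable]: "g \<in> borel_measurable \<mu>" and g0: "\<And>y. 0 \<le> g y" and g1: "\<And>y. g y \<le> 1"
    and w0: "\<And>i. 0 \<le> w i" and xY: "\<And>i. i < n \<Longrightarrow> x i \<in> Y"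
    and mass: "cell_mass \<mu> g (\<lambda>_. True) = atom_mass n x w (\<lambda>_. True)"
    and Bg: "\<And>j. cell_mass \<mu> g (\<lambda>y. J y = j) \<le> B j"
    and Bw: "\<And>j. atom_mass n x w (\<lambda>y. J y = j) \<le> B j"
  shows "\<exists>f. (\<forall>i. f i \<in> borel_measurable \<mu>) \<and> (\<forall>i y. 0 \<le> f i y) \<and>
    (AE y in \<mu>. (\<Sum>i<n. f i y) = g y) \<and>
    (\<forall>i<n. (\<integral>\<^sup>+y. ennreal (f i y) \<partial>\<mu>) = ennreal (w i)) \<and>
    (\<Sum>i<n. \<integral>\<^sup>+y. ennreal (norm (x i - y) powr p * f i y) \<partial>\<mu>) \<le>
      (\<Sum>j. ennreal (R j powr p) * ennreal (4 powr p * B j))"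
proof -
  define m where "m = (\<integral>y. g y \<partial>\<mu>)"
  have gi: "integrable \<mu> g" by (rule integrable_unit_bounded) (use g0 g1 in auto)
  have m_sum: "m = (\<Sum>i<n. w i)" using mass unfolding m_def cell_mass_def atom_mass_def by simp
  have m0: "0 \<le> m" unfolding m_sum by (intro sum_nonneg w0)
  have nng: "(\<integral>\<^sup>+y. ennreal (g y) \<partial>\<mu>) = ennreal m"
    unfolding m_def by (rule nn_integral_eq_integral[OF gi]) (use g0 in auto)
  define f where "f i y = w i / m * g y" for i y
  have fm[measurable]: "f i \<in> borel_measurable \<mu>" for i unfolding f_def by measurable
  have f0: "0 \<le> f i y" for i y unfolding f_def using w0 m0 g0 by simp
  \<comment> \<open>The factor \<open>m / m\<close> is kept since it is \<open>0\<close> for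
    \<open>m = 0\<close>. In that case \<open>g\<close> vanishes only almost everywhere, so the
    densities sum to \<open>g\<close> only almost everywhere.\<close>
  have sumf: "(\<Sum>i<n. f i y) = (m / m) * g y" for y
    unfolding f_def sum_distrib_right[symmetric] sum_divide_distrib[symmetric] m_sum ..
  have fsum: "AE y in \<mu>. (\<Sum>i<n. f i y) = g y"
  proof (cases "m = 0")
    case True
    then have "AE y in \<mu>. g y = 0"
      using integral_nonneg_eq_0_iff_AE[OF gi] g0 unfolding m_def by auto
    then show ?thesis by (eventually_elim) (simp add: sumf)
  qed (simp add: sumf)
  have fint: "(\<integral>\<^sup>+y. ennreal (f i y) \<partial>\<mu>) = ennreal (w i)" if "i < n" for i
  proof (cases "m = 0")
    case True
    then have "w i = 0" using m_sum w0 that by (simp add: sum_nonneg_eq_0_iff)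
    then show ?thesis by (simp add: f_def)
  next
    case False
    have "(\<integral>\<^sup>+y. ennreal (f i y) \<partial>\<mu>) = (\<integral>\<^sup>+y. ennreal (w i / m) * ennreal (g y) \<partial>\<mu>)"
      unfolding f_def using w0 m0 g0 by (intro nn_integral_cong) (simp add: ennreal_mult[symmetric])
    also have "\<dots> = ennreal (w i / m) * ennreal m"
      by (subst nn_integral_cmult) (auto simp: nng)
    also have "\<dots> = ennreal (w i)"
      using False w0 m0 by (simp add: ennreal_mult[symmetric])
    finally show ?thesis .
  qed
  \<comment> \<open>The distance of two points is at most twice the larger of their radii, hence
    \<open>2 powr p\<close>; the power of the maximum is then bounded by the sum of both
    powers.\<close>
  define c where "c j = 2 powr p * R j powr p" for j
  have c0: "0 \<le> c j" for j unfolding c_def by simp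
  have pt: "norm (x i - y) powr p \<le> c (J (x i)) + c (J y)" if "i < n" "y \<in> Y" for i y
  proof -
    have "norm (x i - y) \<le> 2 * max (R (J (x i))) (R (J y))"
      using norm_le[OF xY[OF that(1)]] norm_le[OF that(2)] norm_triangle_ineq4[of "x i" y] by linarith
    then have "norm (x i - y) powr p \<le> (2 * max (R (J (x i))) (R (J y))) powr p"
      using p_ge by (intro powr_mono2) auto
    also have "\<dots> = 2 powr p * max (R (J (x i))) (R (J y)) powr p"
      using R_nonneg by (simp add: powr_mult le_max_iff_disj)
    also have "\<dots> \<le> c (J (x i)) + c (J y)"
      unfolding c_def by (auto simp: max_def)
    finally show ?thesis .
  qed
  have "(\<Sum>i<n. \<integral>\<^sup>+y. ennreal (norm (x i - y) powr p * f i y) \<partial>\<mu>)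
      \<le> (\<Sum>i<n. \<integral>\<^sup>+y. ennreal (c (J (x i))) * ennreal (f i y) + ennreal (c (J y) * f i y) \<partial>\<mu>)"
  proof (intro sum_mono nn_integral_mono_AE)
    fix i assume "i \<in> {..<n}"
    then have i: "i < n" by simp
    show "AE y in \<mu>. ennreal (norm (x i - y) powr p * f i y) \<le> ennreal (c (J (x i))) * ennreal (f i y) + ennreal (c (J y) * f i y)"
      using AE_Y
    proof eventually_elim
      case (elim y)
      have "norm (x i - y) powr p * f i y \<le> (c (J (x i)) + c (J y)) * f i y"
        by (rule mult_right_mono[OF pt[OF i elim] f0])
      then have "ennreal (norm (x i - y) powr p * f i y) \<le> ennreal (c (J (x i)) * f i y + c (J y) * f i y)"
        by (intro ennreal_leI) (simp add: algebra_simps)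
      also have "\<dots> = ennreal (c (J (x i))) * ennreal (f i y) + ennreal (c (J y) * f i y)"
        using c0 f0 by (simp add: ennreal_mult ennreal_plus)
      finally show ?case .
    qed
  qed
  also have "\<dots> = (\<Sum>i<n. ennreal (c (J (x i)) * w i)) + (\<Sum>i<n. \<integral>\<^sup>+y. ennreal (c (J y) * f i y) \<partial>\<mu>)"
  proof -
    have cJ[measurable]: "(\<lambda>y. c (J y)) \<in> borel_measurable \<mu>"
      by (rule measurable_compose[OF J_meas]) simp
    have "(\<integral>\<^sup>+y. ennreal (c (J (x i))) * ennreal (f i y) + ennreal (c (J y) * f i y) \<partial>\<mu>)
      = ennreal (c (J (x i)) * w i) + (\<integral>\<^sup>+y. ennreal (c (J y) * f i y) \<partial>\<mu>)" if "i < n" for i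
      using fint[OF that] c0 w0 by (subst nn_integral_add) (auto simp: nn_integral_cmult ennreal_mult)
    then show ?thesis by (simp add: sum.distrib)
  qed
  also have "(\<Sum>i<n. \<integral>\<^sup>+y. ennreal (c (J y) * f i y) \<partial>\<mu>) = (\<integral>\<^sup>+y. ennreal (c (J y) * g y) \<partial>\<mu>)"
  proof -
    have cJ[measurable]: "(\<lambda>y. c (J y)) \<in> borel_measurable \<mu>"
      by (rule measurable_compose[OF J_meas]) simp
    have "(\<Sum>i<n. \<integral>\<^sup>+y. ennreal (c (J y) * f i y) \<partial>\<mu>) = (\<integral>\<^sup>+y. (\<Sum>i<n. ennreal (c (J y) * f i y)) \<partial>\<mu>)"
      by (rule nn_integral_sum[symmetric]) measurable
    also have "\<dots> = (\<integral>\<^sup>+y. ennreal (c (J y) * g y) \<partial>\<mu>)"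
    proof (rule nn_integral_cong_AE, use fsum in eventually_elim)
      case (elim y)
      then show ?case using c0 f0 by (subst sum_ennreal) (auto simp: sum_distrib_left[symmetric])
    qed
    finally show ?thesis .
  qed
  also have "\<dots> = (\<Sum>j. ennreal (c j) * ennreal (cell_mass \<mu> g (\<lambda>y. J y = j)))"
    by (rule nn_integral_by_index[OF J_meas g g0 g1 c0])
  also have "(\<Sum>i<n. ennreal (c (J (x i)) * w i)) = (\<Sum>j. ennreal (c j) * ennreal (atom_mass n x w (\<lambda>y. J y = j)))"
    by (rule atom_sum_by_index[OF w0 c0])
  also have "(\<Sum>j. ennreal (c j) * ennreal (atom_mass n x w (\<lambda>y. J y = j))) + (\<Sum>j. ennreal (c j) * ennreal (cell_mass \<mu> g (\<lambda>y. J y = j)))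
    = (\<Sum>j. ennreal (c j) * ennreal (atom_mass n x w (\<lambda>y. J y = j)) + ennreal (c j) * ennreal (cell_mass \<mu> g (\<lambda>y. J y = j)))"
    by (rule suminf_add) auto
  also have "\<dots> \<le> (\<Sum>j. ennreal (R j powr p) * ennreal (4 powr p * B j))"
  proof (rule suminf_le)
    fix j
    have B0: "0 \<le> B j" using Bw[of j] atom_mass_nonneg[where w=w and n=n and x=x and P="\<lambda>y. J y = j", OF w0] by linarith
    have "ennreal (c j) * ennreal (atom_mass n x w (\<lambda>y. J y = j)) + ennreal (c j) * ennreal (cell_mass \<mu> g (\<lambda>y. J y = j))
      \<le> ennreal (c j) * ennreal (B j) + ennreal (c j) * ennreal (B j)"
      by (intro add_mono mult_left_mono ennreal_leI Bg Bw) auto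
    also have "\<dots> = ennreal (R j powr p * ((2 * 2 powr p) * B j))"
      using B0 c0[of j] by (simp add: c_def ennreal_mult[symmetric] ennreal_plus[symmetric] algebra_simps del: ennreal_plus)
    also have "\<dots> \<le> ennreal (R j powr p * (4 powr p * B j))"
    proof -
      \<comment> \<open>The extra factor \<open>2\<close> comes from the two marginals;
        \<open>1 \<le> p\<close> absorbs it.\<close>
      have "(2::real) powr 1 * 2 powr p \<le> 2 powr p * 2 powr p"
        using p_ge by (intro mult_right_mono powr_mono) auto
      also have "\<dots> = 4 powr p" by (simp add: powr_mult[symmetric])
      finally show ?thesis using B0 by (intro ennreal_leI mult_left_mono mult_right_mono) auto
    qed
    finally show "ennreal (c j) * ennreal (atom_mass n x w (\<lambda>y. J y = j)) + ennreal (c j) * ennreal (cell_mass \<mu> g (\<lambda>y. J y = j))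
      \<le> ennreal (R j powr p) * ennreal (4 powr p * B j)"
      using B0 by (simp add: ennreal_mult)
  qed auto
  finally show ?thesis using fm f0 fsum fint by blast
qed

text \<open>A stage moves mass only inside the cells of its level, so the discrepancies at all coarser
  levels stay as they were, and the induction hypothesis applies to the leftovers.\<close>

lemma multiscale_transport:
  assumes "k \<le> K" and "g \<in> borel_measurable \<mu>" and "\<And>y. 0 \<le> g y" and "\<And>y. g y \<le> 1"
    and "\<And>i. 0 \<le> w i" and xY: "\<And>i. i < n \<Longrightarrow> x i \<in> Y"
    and "cell_mass \<mu> g (\<lambda>_. True) = atom_mass n x w (\<lambda>_. True)"
    and "\<And>j. cell_mass \<mu> g (\<lambda>y. J y = j) \<le> B j"
    and "\<And>j. atom_mass n x w (\<lambda>y. J y = j) \<le> B j"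
  shows "\<exists>f. (\<forall>i. f i \<in> borel_measurable \<mu>) \<and> (\<forall>i y. 0 \<le> f i y) \<and>
    (AE y in \<mu>. (\<Sum>i<n. f i y) = g y) \<and>
    (\<forall>i<n. (\<integral>\<^sup>+y. ennreal (f i y) \<partial>\<mu>) = ennreal (w i)) \<and>
    (\<Sum>i<n. \<integral>\<^sup>+y. ennreal (norm (x i - y) powr p * f i y) \<partial>\<mu>) \<le>
      (\<Sum>j. ennreal (R j powr p) *
        ennreal (scale_weight k * B j + (\<Sum>l<k. scale_weight l * discrepancy g n x w l j)))"
  using assms(1-5) assms(7-9)
\<comment> \<open>The case \<open>Suc k\<close> first treats level \<open>k\<close>, the finest one
  present; the hypothesis then handles the leftovers at the levels below \<open>k\<close>, so
  \<open>g\<close>, \<open>w\<close> and \<open>B\<close> have to vary.\<close>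
proof (induction k arbitrary: g w B)
  case 0
  show ?case
    using product_transport[OF "0.prems"(2-5) xY "0.prems"(6-8)] by (simp add: scale_weight_def)
next
  case (Suc k)
  note g[measurable] = Suc.prems(2) and g0 = Suc.prems(3) and g1 = Suc.prems(4) and w0 = Suc.prems(5)
  have kK: "k < K" using Suc.prems(1) by simp
  have Jeq[measurable]: "Measurable.pred \<mu> (\<lambda>y. J y = j)" for j
    by (rule measurable_compose[OF J_meas]) simp
  have Teq[measurable]: "Measurable.pred \<mu> (\<lambda>y. T l y = i)" if "l < K" for l i
    by (rule measurable_compose[OF T_meas[OF that]]) simp
  \<comment> \<open>Cells are labelled by pairs, so that mass can change its layer only in the base
    case.\<close>
  have label: "(\<lambda>y. (J y, T k y)) \<in> measurable \<mu> (count_space UNIV)"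
    by (rule measurable_compose_countable[OF _ J_meas], rule measurable_compose[OF T_meas[OF kK]]) simp
  obtain f where fm[measurable]: "\<And>i. f i \<in> borel_measurable \<mu>" and f0: "\<And>i y. 0 \<le> f i y"
    and fg: "\<And>y. (\<Sum>i<n. f i y) \<le> g y" and fw: "\<And>i. (\<integral>y. f i y \<partial>\<mu>) \<le> w i"
    and supp': "\<And>i y. f i y \<noteq> 0 \<Longrightarrow> (J y, T k y) = (J (x i), T k (x i))"
    and gk: "\<And>c. cell_mass \<mu> (\<lambda>y. g y - (\<Sum>i<n. f i y)) (\<lambda>y. (J y, T k y) = c) =
      max 0 (cell_mass \<mu> g (\<lambda>y. (J y, T k y) = c) - atom_mass n x w (\<lambda>y. (J y, T k y) = c))"
    and wk: "\<And>c. atom_mass n x (\<lambda>i. w i - (\<integral>y. f i y \<partial>\<mu>)) (\<lambda>y. (J y, T k y) = c) =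
      max 0 (atom_mass n x w (\<lambda>y. (J y, T k y) = c) - cell_mass \<mu> g (\<lambda>y. (J y, T k y) = c))"
    by (rule greedy_stage[where n=n and x=x and w=w and g=g, OF label g g0 g1 w0]) (rule that, assumption+)
  have supp: "J y = J (x i)" "T k y = T k (x i)" if "f i y \<noteq> 0" for i y
    using supp'[OF that] by auto
  define g' where "g' y = g y - (\<Sum>i<n. f i y)" for y
  define w' where "w' i = w i - (\<integral>y. f i y \<partial>\<mu>)" for i
  have g'm[measurable]: "g' \<in> borel_measurable \<mu>" unfolding g'_def by measurable
  have g'0: "0 \<le> g' y" for y unfolding g'_def using fg by simp
  have g'1: "g' y \<le> 1" for y unfolding g'_def using g1[of y] sum_nonneg[of "{..<n}" "\<lambda>i. f i y"] f0 by fastforce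
  have w'0: "0 \<le> w' i" for i unfolding w'_def using fw by simp
  have inv: "cell_mass \<mu> g' P - atom_mass n x w' P = cell_mass \<mu> g P - atom_mass n x w P"
    if "Measurable.pred \<mu> P" "\<And>i y. f i y \<noteq> 0 \<Longrightarrow> P y = P (x i)" for P
    unfolding g'_def w'_def by (rule mass_difference_invariant[OF g g1 fm f0 fg that])
  have mass': "cell_mass \<mu> g' (\<lambda>_. True) = atom_mass n x w' (\<lambda>_. True)"
    using inv[of "\<lambda>_. True"] Suc.prems(6) by simp
  have disc: "discrepancy g' n x w' l j = discrepancy g n x w l j" if "l < k" for l j
  proof -
    have lK: "l < K" using that kK by simp
    have "cell_mass \<mu> g' (\<lambda>y. J y = j \<and> T l y = i) - atom_mass n x w' (\<lambda>y. J y = j \<and> T l y = i)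
      = cell_mass \<mu> g (\<lambda>y. J y = j \<and> T l y = i) - atom_mass n x w (\<lambda>y. J y = j \<and> T l y = i)" for i
    proof (rule inv)
      show "Measurable.pred \<mu> (\<lambda>y. J y = j \<and> T l y = i)" using Jeq Teq[OF lK] by simp
      show "(J y = j \<and> T l y = i) = (J (x a) = j \<and> T l (x a) = i)" if "f a y \<noteq> 0" for a y
        \<comment> \<open>By nestedness, points in one cell of level \<open>k\<close> also share
          their cell of level \<open>l\<close>, so \<open>f\<close> never leaves a coarser
          cell.\<close>
        using supp[OF that] T_nested'[where l=l and m=k and y=y and z="x a"] \<open>l < k\<close> kK by simp
    qed
    then show ?thesis unfolding discrepancy_def by simp
  qed
  \<comment> \<open>In each layer the leftovers of either measure are positive or negative parts of
    cell differences, so the discrepancy at level \<open>k\<close> takes over as the common mass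
    bound.\<close>
  define B' where "B' j = discrepancy g n x w k j" for j
  have Bg': "cell_mass \<mu> g' (\<lambda>y. J y = j) \<le> B' j" for j
  proof -
    have "cell_mass \<mu> g' (\<lambda>y. J y = j) = (\<Sum>i<N k. cell_mass \<mu> g' (\<lambda>y. J y = j \<and> T k y = i))"
      by (rule cell_mass_split[OF T_meas[OF kK] J_meas g'm g'0 g'1 T_less[OF kK]])
    also have "\<dots> \<le> B' j"
      unfolding B'_def discrepancy_def
    proof (rule sum_mono)
      show "cell_mass \<mu> g' (\<lambda>y. J y = j \<and> T k y = i) \<le> \<bar>cell_mass \<mu> g (\<lambda>y. J y = j \<and> T k y = i)
         - atom_mass n x w (\<lambda>y. J y = j \<and> T k y = i)\<bar>" for i
        using gk[of "(j, i)"] unfolding g'_def by simp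
    qed
    finally show ?thesis .
  qed
  have Bw': "atom_mass n x w' (\<lambda>y. J y = j) \<le> B' j" for j
  proof -
    have "atom_mass n x w' (\<lambda>y. J y = j) = (\<Sum>i<N k. atom_mass n x w' (\<lambda>y. J y = j \<and> T k y = i))"
      by (rule atom_mass_split[OF T_less[OF kK]])
    also have "\<dots> \<le> B' j"
      unfolding B'_def discrepancy_def
    proof (rule sum_mono)
      show "atom_mass n x w' (\<lambda>y. J y = j \<and> T k y = i) \<le> \<bar>cell_mass \<mu> g (\<lambda>y. J y = j \<and> T k y = i)
         - atom_mass n x w (\<lambda>y. J y = j \<and> T k y = i)\<bar>" for i
        using wk[of "(j, i)"] unfolding w'_def by simp
    qed
    finally show ?thesis .
  qed
  obtain h where hm[measurable]: "\<And>i. h i \<in> borel_measurable \<mu>" and h0: "\<And>i y. 0 \<le> h i y"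
    and hsum: "AE y in \<mu>. (\<Sum>i<n. h i y) = g' y"
    and hint: "\<And>i. i < n \<Longrightarrow> (\<integral>\<^sup>+y. ennreal (h i y) \<partial>\<mu>) = ennreal (w' i)"
    and hcost: "(\<Sum>i<n. \<integral>\<^sup>+y. ennreal (norm (x i - y) powr p * h i y) \<partial>\<mu>) \<le>
      (\<Sum>j. ennreal (R j powr p) *
        ennreal (scale_weight k * B' j + (\<Sum>l<k. scale_weight l * discrepancy g' n x w' l j)))"
    using Suc.IH[OF _ g'm g'0 g'1 w'0 mass' Bg' Bw'] kK by auto
  have distm[measurable]: "(\<lambda>y. norm (x i - y) powr p) \<in> borel_measurable \<mu>" for i
  proof -
    have "(\<lambda>y. norm (x i - y)) \<in> borel_measurable borel"
      by (intro borel_measurable_continuous_onI continuous_intros)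
    then have [measurable]: "(\<lambda>y. norm (x i - y)) \<in> borel_measurable \<mu>"
      by (simp add: measurable_cong_sets[OF sets_mu refl])
    show ?thesis by measurable
  qed
  define c where "c j = R j powr p * 3 powr (- p * real k)" for j
  have c0: "0 \<le> c j" for j unfolding c_def by simp
  have cJ[measurable]: "(\<lambda>y. c (J y)) \<in> borel_measurable \<mu>"
    by (rule measurable_compose[OF J_meas]) simp
  \<comment> \<open>At most the mass \<open>B j\<close> moves inside layer \<open>j\<close>, over a
    distance of at most the cell diameter \<open>R j / 3 ^ k\<close>.\<close>
  have fcost: "(\<Sum>i<n. \<integral>\<^sup>+y. ennreal (norm (x i - y) powr p * f i y) \<partial>\<mu>) \<le>
     (\<Sum>j. ennreal (R j powr p) * ennreal (scale_weight (Suc k) * B j))"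
  proof -
    have "(\<Sum>i<n. \<integral>\<^sup>+y. ennreal (norm (x i - y) powr p * f i y) \<partial>\<mu>)
      \<le> (\<Sum>i<n. \<integral>\<^sup>+y. ennreal (c (J y) * f i y) \<partial>\<mu>)"
    proof (intro sum_mono nn_integral_mono_AE)
      fix i assume "i \<in> {..<n}"
      then have i: "i < n" by simp
      show "AE y in \<mu>. ennreal (norm (x i - y) powr p * f i y) \<le> ennreal (c (J y) * f i y)"
        using AE_Y
      proof eventually_elim
        case (elim y)
        show ?case
        proof (cases "f i y = 0")
          case False
          have "norm (x i - y) \<le> R (J y) / 3 ^ k"
            by (rule diam_le[OF kK elim xY[OF i] supp[OF False]])
          then have "norm (x i - y) powr p \<le> (R (J y) / 3 ^ k) powr p"
            using p_ge by (intro powr_mono2) auto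
          also have "\<dots> = c (J y)"
            using R_nonneg[of "J y"] unfolding c_def
            by (simp add: powr_divide powr_realpow[symmetric] powr_powr powr_minus field_simps)
          finally show ?thesis using f0 by (intro ennreal_leI mult_right_mono) auto
        qed simp
      qed
    qed
    also have "\<dots> = (\<integral>\<^sup>+y. (\<Sum>i<n. ennreal (c (J y) * f i y)) \<partial>\<mu>)"
      by (rule nn_integral_sum[symmetric]) measurable
    also have "\<dots> \<le> (\<integral>\<^sup>+y. ennreal (c (J y) * g y) \<partial>\<mu>)"
    proof (rule nn_integral_mono)
      fix y
      have "(\<Sum>i<n. ennreal (c (J y) * f i y)) = ennreal (c (J y) * (\<Sum>i<n. f i y))"
        using c0 f0 by (subst sum_ennreal) (auto simp: sum_distrib_left)
      also have "\<dots> \<le> ennreal (c (J y) * g y)"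
        by (intro ennreal_leI mult_left_mono fg c0)
      finally show "(\<Sum>i<n. ennreal (c (J y) * f i y)) \<le> ennreal (c (J y) * g y)" .
    qed
    also have "\<dots> = (\<Sum>j. ennreal (c j) * ennreal (cell_mass \<mu> g (\<lambda>y. J y = j)))"
      by (rule nn_integral_by_index[OF J_meas g g0 g1 c0])
    also have "\<dots> \<le> (\<Sum>j. ennreal (R j powr p) * ennreal (scale_weight (Suc k) * B j))"
    proof (rule suminf_le)
      fix j
      have B0: "0 \<le> B j" using Suc.prems(7)[of j] cell_mass_nonneg[where g=g and \<mu>=\<mu> and P="\<lambda>y. J y = j", OF g0] by linarith
      \<comment> \<open>Index shift: a move inside cells of level \<open>k\<close> is charged as
        \<open>scale_weight (Suc k)\<close>, and the factor \<open>3 powr p \<le> 4 powr p\<close>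
        makes up for the extra level.\<close>
      have "3 powr p * 3 powr (- p * real (Suc k)) = 3 powr (- p * real k)"
        by (simp add: powr_add[symmetric] algebra_simps)
      moreover have "3 powr p * 3 powr (- p * real (Suc k)) \<le> scale_weight (Suc k)"
        unfolding scale_weight_def using p_ge by (intro mult_right_mono powr_mono2) auto
      ultimately have "3 powr (- p * real k) \<le> scale_weight (Suc k)" by simp
      then have "c j * B j \<le> R j powr p * (scale_weight (Suc k) * B j)"
        unfolding c_def mult.assoc using B0 by (intro mult_left_mono mult_right_mono) auto
      have "ennreal (c j) * ennreal (cell_mass \<mu> g (\<lambda>y. J y = j)) \<le> ennreal (c j) * ennreal (B j)"
        by (intro mult_left_mono ennreal_leI Suc.prems(7)) auto
      also have "\<dots> = ennreal (c j * B j)" using c0 B0 by (simp add: ennreal_mult)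
      also have "\<dots> \<le> ennreal (R j powr p * (scale_weight (Suc k) * B j))" by (rule ennreal_leI) fact
      also have "\<dots> = ennreal (R j powr p) * ennreal (scale_weight (Suc k) * B j)"
        using B0 by (intro ennreal_mult) (auto simp: scale_weight_def)
      finally show "ennreal (c j) * ennreal (cell_mass \<mu> g (\<lambda>y. J y = j))
        \<le> ennreal (R j powr p) * ennreal (scale_weight (Suc k) * B j)" .
    qed auto
    finally show ?thesis .
  qed
  have fle1: "f i y \<le> 1" if "i < n" for i y
    using member_le_sum[of i "{..<n}" "\<lambda>i. f i y"] that f0 fg[of y] g1[of y] by fastforce
  have fint: "(\<integral>\<^sup>+y. ennreal (f i y) \<partial>\<mu>) = ennreal (\<integral>y. f i y \<partial>\<mu>)" if "i < n" for i
    by (rule nn_integral_eq_integral[OF integrable_unit_bounded]) (use f0 fle1[OF that] in auto)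
  have sw0: "0 \<le> scale_weight l" for l unfolding scale_weight_def by simp
  have d0: "0 \<le> discrepancy g n x w l j" for l j unfolding discrepancy_def by (intro sum_nonneg) simp
  let ?f = "\<lambda>i y. f i y + h i y"
  show ?case
  proof (intro exI[of _ ?f] conjI allI impI)
    show "?f i \<in> borel_measurable \<mu>" for i by measurable
    show "0 \<le> ?f i y" for i y using f0 h0 by simp
    show "AE y in \<mu>. (\<Sum>i<n. ?f i y) = g y"
      using hsum by eventually_elim (simp add: sum.distrib g'_def)
    show "(\<integral>\<^sup>+y. ennreal (?f i y) \<partial>\<mu>) = ennreal (w i)" if "i < n" for i
    proof -
      have "(\<integral>\<^sup>+y. ennreal (?f i y) \<partial>\<mu>) = ennreal (\<integral>y. f i y \<partial>\<mu>) + ennreal (w' i)"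
        using f0 h0 by (simp add: nn_integral_add fint[OF that] hint[OF that])
      also have "\<dots> = ennreal (w i)"
        using f0 w'0[of i] unfolding w'_def by (subst ennreal_plus[symmetric]) (auto intro: integral_nonneg_AE)
      finally show ?thesis .
    qed
    have "(\<Sum>i<n. \<integral>\<^sup>+y. ennreal (norm (x i - y) powr p * ?f i y) \<partial>\<mu>)
      = (\<Sum>i<n. \<integral>\<^sup>+y. ennreal (norm (x i - y) powr p * f i y) \<partial>\<mu>)
      + (\<Sum>i<n. \<integral>\<^sup>+y. ennreal (norm (x i - y) powr p * h i y) \<partial>\<mu>)"
      using f0 h0 unfolding sum.distrib[symmetric]
      by (intro sum.cong) (auto simp: nn_integral_add[symmetric] distrib_left ennreal_plus[symmetric] simp del: ennreal_plus)
    also have "\<dots> \<le> (\<Sum>j. ennreal (R j powr p) * ennreal (scale_weight (Suc k) * B j))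
      + (\<Sum>j. ennreal (R j powr p) *
        ennreal (scale_weight k * B' j + (\<Sum>l<k. scale_weight l * discrepancy g' n x w' l j)))"
      by (rule add_mono[OF fcost hcost])
    also have "\<dots> = (\<Sum>j. ennreal (R j powr p) * ennreal (scale_weight (Suc k) * B j) + ennreal (R j powr p) *
        ennreal (scale_weight k * B' j + (\<Sum>l<k. scale_weight l * discrepancy g' n x w' l j)))"
      by (rule suminf_add) auto
    also have "\<dots> = (\<Sum>j. ennreal (R j powr p) *
        ennreal (scale_weight (Suc k) * B j + (\<Sum>l<Suc k. scale_weight l * discrepancy g n x w l j)))"
    proof (rule suminf_cong)
      fix j
      have B0: "0 \<le> B j" using Suc.prems(7)[of j] cell_mass_nonneg[where g=g and \<mu>=\<mu> and P="\<lambda>y. J y = j", OF g0] by linarith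
      \<comment> \<open>The mass bound of the leftovers is exactly the summand \<open>l = k\<close>
        of the enlarged sum; the other summands are unchanged by the stage.\<close>
      have "scale_weight k * B' j + (\<Sum>l<k. scale_weight l * discrepancy g' n x w' l j)
        = (\<Sum>l<Suc k. scale_weight l * discrepancy g n x w l j)"
        by (simp add: disc B'_def)
      moreover have "0 \<le> (\<Sum>l<Suc k. scale_weight l * discrepancy g n x w l j)"
        by (intro sum_nonneg mult_nonneg_nonneg sw0 d0)
      ultimately show "ennreal (R j powr p) * ennreal (scale_weight (Suc k) * B j) + ennreal (R j powr p) *
        ennreal (scale_weight k * B' j + (\<Sum>l<k. scale_weight l * discrepancy g' n x w' l j)) =
        ennreal (R j powr p) *
        ennreal (scale_weight (Suc k) * B j + (\<Sum>l<Suc k. scale_weight l * discrepancy g n x w l j))"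
        using B0 sw0 by (simp only: distrib_left[symmetric]) (subst ennreal_plus[symmetric], auto)
    qed
    finally show "(\<Sum>i<n. \<integral>\<^sup>+y. ennreal (norm (x i - y) powr p * ?f i y) \<partial>\<mu>) \<le> (\<Sum>j. ennreal (R j powr p) *
        ennreal (scale_weight (Suc k) * B j + (\<Sum>l<Suc k. scale_weight l * discrepancy g n x w l j)))" .
  qed
qed

end

section \<open>Couplings from transport densities\<close>

lemma epowr_mono: "x \<le> y \<Longrightarrow> 0 \<le> a \<Longrightarrow> x epowr a \<le> y epowr a"
  unfolding epowr_def
  by (auto simp: top_unique less_top intro!: ennreal_leI powr_mono2 enn2real_mono)

lemma epowr_epowr_inverse: "0 < a \<Longrightarrow> (x epowr (1 / a)) epowr a = x"
  unfolding epowr_def by (auto simp: powr_powr ennreal_enn2real_if)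

lemma epowr_ennreal: "0 \<le> x \<Longrightarrow> ennreal x epowr a = ennreal (x powr a)"
  unfolding epowr_def by simp

lemma wasserstein_epowr_le:
  assumes "\<xi> \<in> couplings \<mu> \<nu>" "0 < p"
  shows "wasserstein p \<mu> \<nu> epowr p \<le> (\<integral>\<^sup>+z. ennreal (norm (fst z - snd z) powr p) \<partial>\<xi>)"
proof -
  have "wasserstein p \<mu> \<nu> \<le> (\<integral>\<^sup>+z. ennreal (norm (fst z - snd z) powr p) \<partial>\<xi>) epowr (1 / p)"
    unfolding wasserstein_def by (rule INF_lower) fact
  from epowr_mono[OF this, of p] show ?thesis using assms(2) by (simp add: epowr_epowr_inverse)
qed

text \<open>The coupling is the image of the measure with density \<open>f i y\<close> on pairs of
  an index and a point under the map \<open>(i, y) \<mapsto> (x i, y)\<close>. The integrals of the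
  \<open>f i\<close> give the empirical marginal, their sum gives \<open>\<mu>\<close>. Mass is
  attached to indices rather than points, so coinciding samples are harmless.\<close>

lemma wasserstein_le_transport:
  fixes \<mu> :: "'a::real_normed_vector measure" and f :: "nat \<Rightarrow> 'a \<Rightarrow> real"
  assumes \<mu>: "prob_space \<mu>" and sets_mu: "sets \<mu> = sets borel" and n: "1 \<le> n" and p: "0 < p"
    and fm: "\<And>i. f i \<in> borel_measurable \<mu>"
    and fsum: "AE y in \<mu>. (\<Sum>i<n. f i y) = 1" and f0: "\<And>i y. 0 \<le> f i y"
    and fint: "\<And>i. i < n \<Longrightarrow> (\<integral>\<^sup>+y. ennreal (f i y) \<partial>\<mu>) = ennreal (1 / real n)"
  shows "wasserstein p (empirical_measure n x) \<mu> epowr p \<le>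
    (\<Sum>i<n. \<integral>\<^sup>+y. ennreal (norm (x i - y) powr p * f i y) \<partial>\<mu>)"
proof -
  interpret \<mu>: prob_space \<mu> by fact
  have sm: "space \<mu> = UNIV" using sets_eq_imp_space_eq[OF sets_mu] by simp
  define D where "D = density (count_space {..<n} \<Otimes>\<^sub>M \<mu>) (\<lambda>(i, y). ennreal (f i y))"
  define h where "h = (\<lambda>(i :: nat, y :: 'a). (x i, y))"
  define \<xi> where "\<xi> = distr D borel h"
  have fm': "(\<lambda>(i, y). ennreal (f i y)) \<in> borel_measurable (count_space {..<n} \<Otimes>\<^sub>M \<mu>)"
    by (rule measurable_pair_measure_countable1) (use fm in auto)
  \<comment> \<open>For fixed \<open>i\<close> the map is continuous into the topological product,
    hence Borel. With finitely many indices this slicewise measurability suffices for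
    \<open>h\<close>.\<close>
  have pair: "(\<lambda>y. (x i, y)) \<in> measurable \<mu> borel" for i
  proof -
    have "(\<lambda>y. (x i, y)) \<in> measurable borel borel"
      by (intro borel_measurable_continuous_onI continuous_intros)
    then show ?thesis by (simp add: measurable_cong_sets[OF sets_mu refl])
  qed
  have hm: "h \<in> measurable (count_space {..<n} \<Otimes>\<^sub>M \<mu>) borel"
    unfolding h_def by (rule measurable_pair_measure_countable1) (use pair in auto)
  then have hmD: "h \<in> measurable D borel" unfolding D_def by simp
  \<comment> \<open>Both marginals, through indicators, and the cost are read off from this
    formula.\<close>
  have int_xi: "(\<integral>\<^sup>+z. \<phi> z \<partial>\<xi>) = (\<Sum>i<n. \<integral>\<^sup>+y. ennreal (f i y) * \<phi> (x i, y) \<partial>\<mu>)"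
    if [measurable]: "\<phi> \<in> borel_measurable borel" for \<phi>
  proof -
    have "(\<integral>\<^sup>+z. \<phi> z \<partial>\<xi>) = (\<integral>\<^sup>+z. \<phi> (h z) \<partial>D)"
      unfolding \<xi>_def by (rule nn_integral_distr[OF hmD]) measurable
    also have "\<dots> = (\<integral>\<^sup>+z. (case z of (i, y) \<Rightarrow> ennreal (f i y)) * \<phi> (h z) \<partial>(count_space {..<n} \<Otimes>\<^sub>M \<mu>))"
      unfolding D_def by (rule nn_integral_density[OF fm']) (use measurable_compose[OF hm that] in simp)
    also have "\<dots> = (\<integral>\<^sup>+i. \<integral>\<^sup>+y. ennreal (f i y) * \<phi> (x i, y) \<partial>\<mu> \<partial>count_space {..<n})"
      by (subst \<mu>.nn_integral_fst[symmetric])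
        (use fm' measurable_compose[OF hm that] in \<open>auto simp: h_def intro!: borel_measurable_times_ennreal\<close>)
    also have "\<dots> = (\<Sum>i<n. \<integral>\<^sup>+y. ennreal (f i y) * \<phi> (x i, y) \<partial>\<mu>)"
      by (simp add: nn_integral_count_space_finite)
    finally show ?thesis .
  qed
  have em: "emeasure \<xi> A = (\<Sum>i<n. \<integral>\<^sup>+y. ennreal (f i y) * indicator A (x i, y) \<partial>\<mu>)" if "A \<in> sets borel" for A
  proof -
    have "emeasure \<xi> A = (\<integral>\<^sup>+z. indicator A z \<partial>\<xi>)" by (rule nn_integral_indicator[symmetric]) (use that in \<open>simp add: \<xi>_def\<close>)
    then show ?thesis using int_xi[of "indicator A"] that by simp
  qed
  have fst: "distr \<xi> borel fst = empirical_measure n x"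
  proof (rule measure_eqI)
    fix A :: "'a set" assume "A \<in> sets (distr \<xi> borel fst)"
    then have A[measurable]: "A \<in> sets borel" by simp
    have fstm: "fst \<in> measurable (borel :: ('a \<times> 'a) measure) borel"
      by (intro borel_measurable_continuous_onI continuous_intros)
    have "emeasure (distr \<xi> borel fst) A = emeasure \<xi> (fst -` A)"
      by (subst emeasure_distr) (use fstm in \<open>auto simp: \<xi>_def\<close>)
    also have "\<dots> = (\<Sum>i<n. \<integral>\<^sup>+y. ennreal (f i y) * indicator (fst -` A) (x i, y) \<partial>\<mu>)"
      by (rule em) (use measurable_sets[OF fstm A] in simp)
    also have "\<dots> = (\<Sum>i<n. ennreal (1 / real n) * indicator A (x i))"
    proof (rule sum.cong)
      fix i assume "i \<in> {..<n}"
      then have i: "i < n" by simp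
      have "(\<integral>\<^sup>+y. ennreal (f i y) * indicator (fst -` A) (x i, y) \<partial>\<mu>) = (\<integral>\<^sup>+y. ennreal (f i y) * indicator A (x i) \<partial>\<mu>)"
        by (intro nn_integral_cong) (auto simp: indicator_def)
      also have "\<dots> = ennreal (1 / real n) * indicator A (x i)"
        using fint[OF i] fm by (simp add: nn_integral_multc)
      finally show "(\<integral>\<^sup>+y. ennreal (f i y) * indicator (fst -` A) (x i, y) \<partial>\<mu>) = ennreal (1 / real n) * indicator A (x i)" .
    qed simp
    also have "\<dots> = emeasure (empirical_measure n x) A"
    proof -
      have ne: "{..<n} \<noteq> {}" using n by (simp add: lessThan_empty_iff)
      have "emeasure (empirical_measure n x) A = emeasure (measure_pmf (pmf_of_set {..<n})) (x -` A)"
        unfolding empirical_measure_def by (subst emeasure_distr) auto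
      also have "\<dots> = (\<integral>\<^sup>+i. indicator A (x i) \<partial>measure_pmf (pmf_of_set {..<n}))"
      proof -
        have "(\<lambda>i. indicator A (x i) :: ennreal) = indicator (x -` A)" by (auto simp: indicator_def)
        then show ?thesis by simp
      qed
      also have "\<dots> = (\<Sum>i<n. indicator A (x i)) / ennreal (real n)"
        using ne by (subst nn_integral_pmf_of_set) (auto simp: ennreal_of_nat_eq_real_of_nat)
      also have "\<dots> = (\<Sum>i<n. ennreal (1 / real n) * indicator A (x i))"
      proof -
        have "inverse (ennreal (real n)) = ennreal (1 / real n)"
          using n by (simp add: inverse_ennreal inverse_eq_divide)
        then show ?thesis unfolding sum_distrib_left[symmetric] divide_ennreal_def by (simp only: mult.commute)
      qed
      finally show ?thesis by simp
    qed
    finally show "emeasure (distr \<xi> borel fst) A = emeasure (empirical_measure n x) A" .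
  qed (simp add: empirical_measure_def)
  have snd: "distr \<xi> borel snd = \<mu>"
  proof (rule measure_eqI)
    fix A :: "'a set" assume "A \<in> sets (distr \<xi> borel snd)"
    then have A: "A \<in> sets borel" by simp
    then have A'[measurable]: "A \<in> sets \<mu>" using sets_mu by simp
    note fm[measurable]
    have sndm: "snd \<in> measurable (borel :: ('a \<times> 'a) measure) borel"
      by (intro borel_measurable_continuous_onI continuous_intros)
    have "emeasure (distr \<xi> borel snd) A = emeasure \<xi> (snd -` A)"
      by (subst emeasure_distr) (use sndm A in \<open>auto simp: \<xi>_def\<close>)
    also have "\<dots> = (\<Sum>i<n. \<integral>\<^sup>+y. ennreal (f i y) * indicator (snd -` A) (x i, y) \<partial>\<mu>)"
      by (rule em) (use measurable_sets[OF sndm A] in simp)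
    also have "\<dots> = (\<Sum>i<n. \<integral>\<^sup>+y. ennreal (f i y) * indicator A y \<partial>\<mu>)"
      by (intro sum.cong nn_integral_cong) (auto simp: indicator_def)
    also have "\<dots> = (\<integral>\<^sup>+y. (\<Sum>i<n. ennreal (f i y) * indicator A y) \<partial>\<mu>)"
      by (rule nn_integral_sum[symmetric]) measurable
    also have "\<dots> = (\<integral>\<^sup>+y. indicator A y \<partial>\<mu>)"
    proof (rule nn_integral_cong_AE, use fsum in eventually_elim)
      case (elim y)
      then show ?case using f0 by (simp add: sum_distrib_right[symmetric] sum_ennreal)
    qed
    also have "\<dots> = emeasure \<mu> A" by simp
    finally show "emeasure (distr \<xi> borel snd) A = emeasure \<mu> A" .
  qed (simp add: sets_mu)
  have "\<xi> \<in> couplings (empirical_measure n x) \<mu>"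
  proof -
    have "emeasure \<xi> (space \<xi>) = emeasure (distr \<xi> borel snd) UNIV"
      by (subst emeasure_distr) (auto simp: \<xi>_def intro!: borel_measurable_continuous_onI continuous_intros)
    also have "\<dots> = 1" using \<mu>.emeasure_space_1 sm by (simp add: snd)
    finally have "prob_space \<xi>" by (rule prob_spaceI)
    then show ?thesis using fst snd unfolding couplings_def by (simp add: \<xi>_def)
  qed
  from wasserstein_epowr_le[OF this p]
  have "wasserstein p (empirical_measure n x) \<mu> epowr p \<le> (\<integral>\<^sup>+z. ennreal (norm (fst z - snd z) powr p) \<partial>\<xi>)" .
  also have "\<dots> = (\<Sum>i<n. \<integral>\<^sup>+y. ennreal (f i y) * ennreal (norm (x i - y) powr p) \<partial>\<mu>)"
  proof -
    have "(\<lambda>z::'a\<times>'a. norm (fst z - snd z)) \<in> borel_measurable borel"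
      by (intro borel_measurable_continuous_onI continuous_intros)
    then have "(\<lambda>z::'a\<times>'a. ennreal (norm (fst z - snd z) powr p)) \<in> borel_measurable borel"
      by measurable
    from int_xi[OF this] show ?thesis by simp
  qed
  also have "\<dots> = (\<Sum>i<n. \<integral>\<^sup>+y. ennreal (norm (x i - y) powr p * f i y) \<partial>\<mu>)"
    using f0 by (simp add: ennreal_mult mult.commute)
  finally show ?thesis .
qed

section \<open>Expected discrepancies\<close>

text \<open>Independence and centring remove the mixed terms from the second moment of the sum,
  leaving at most \<open>n * c\<close>; the first absolute moment is at most its square
  root.\<close>

lemma (in prob_space) expectation_abs_sum_indep_le:
  fixes Z :: "nat \<Rightarrow> 'a \<Rightarrow> real"
  assumes ind: "indep_vars (\<lambda>_. borel) Z {..<n}" and c: "0 \<le> c"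
    and bd: "\<And>i \<omega>. i < n \<Longrightarrow> \<bar>Z i \<omega>\<bar> \<le> 1"
    and mean: "\<And>i. i < n \<Longrightarrow> expectation (Z i) = 0"
    and var: "\<And>i. i < n \<Longrightarrow> expectation (\<lambda>\<omega>. (Z i \<omega>)\<^sup>2) \<le> c"
  shows "expectation (\<lambda>\<omega>. \<bar>\<Sum>i<n. Z i \<omega>\<bar>) \<le> sqrt (real n * c)"
proof -
  have Zm: "Z i \<in> borel_measurable M" if "i < n" for i
    using ind that unfolding indep_vars_def by auto
  have Zi: "integrable M (Z i)" if "i < n" for i
    by (rule integrable_const_bound[where B=1]) (use bd Zm that in auto)
  have ZZi: "integrable M (\<lambda>\<omega>. Z i \<omega> * Z k \<omega>)" if "i < n" "k < n" for i k
  proof (rule integrable_const_bound[where B=1])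
    show "AE \<omega> in M. norm (Z i \<omega> * Z k \<omega>) \<le> 1"
      using bd that by (auto simp: abs_mult intro!: mult_le_one)
  qed (use Zm that in auto)
  define S where "S \<omega> = (\<Sum>i<n. Z i \<omega>)" for \<omega>
  have Si: "integrable M S" unfolding S_def using Zi by auto
  have sq: "(S \<omega>)\<^sup>2 = (\<Sum>i<n. \<Sum>k<n. Z i \<omega> * Z k \<omega>)" for \<omega>
    unfolding S_def power2_eq_square sum_product ..
  have SSi: "integrable M (\<lambda>\<omega>. (S \<omega>)\<^sup>2)" unfolding sq by (intro Bochner_Integration.integrable_sum ZZi) auto
  have cov: "expectation (\<lambda>\<omega>. Z i \<omega> * Z k \<omega>) \<le> (if i = k then c else 0)" if "i < n" "k < n" for i k
  proof (cases "i = k")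
    case True
    then show ?thesis using var[of i] that by (simp add: power2_eq_square)
  next
    case False
    have "indep_vars (\<lambda>_. borel) Z {i, k}" by (rule indep_vars_subset[OF ind]) (use that in auto)
    then have "expectation (\<lambda>\<omega>. \<Prod>j\<in>{i, k}. Z j \<omega>) = (\<Prod>j\<in>{i, k}. expectation (Z j))"
      by (intro indep_vars_lebesgue_integral) (use that Zi in auto)
    then show ?thesis using False mean that by simp
  qed
  have "expectation (\<lambda>\<omega>. (S \<omega>)\<^sup>2) = (\<Sum>i<n. \<Sum>k<n. expectation (\<lambda>\<omega>. Z i \<omega> * Z k \<omega>))"
    unfolding sq
    by (subst Bochner_Integration.integral_sum, intro Bochner_Integration.integrable_sum ZZi)
      (auto intro!: sum.cong Bochner_Integration.integral_sum ZZi)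
  also have "\<dots> \<le> (\<Sum>i<n. \<Sum>k<n. if i = k then c else 0)"
    by (intro sum_mono cov) auto
  also have "\<dots> = real n * c" by simp
  finally have ES: "expectation (\<lambda>\<omega>. (S \<omega>)\<^sup>2) \<le> real n * c" .
  \<comment> \<open>Nonnegativity of this variance says that the squared mean of
    \<open>\<bar>S\<bar>\<close> is at most the second moment.\<close>
  have "0 \<le> variance (\<lambda>\<omega>. \<bar>S \<omega>\<bar>)" by (rule variance_positive)
  also have "\<dots> = expectation (\<lambda>\<omega>. (S \<omega>)\<^sup>2) - (expectation (\<lambda>\<omega>. \<bar>S \<omega>\<bar>))\<^sup>2"
    using Si SSi by (subst variance_eq) auto
  finally have "(expectation (\<lambda>\<omega>. \<bar>S \<omega>\<bar>))\<^sup>2 \<le> real n * c" using ES by simp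
  then have "expectation (\<lambda>\<omega>. \<bar>S \<omega>\<bar>) \<le> sqrt (real n * c)" by (rule real_le_rsqrt)
  then show ?thesis unfolding S_def .
qed

text \<open>A centred indicator has variance \<open>a - a\<^sup>2 \<le> a\<close>. Keeping the mass
  under the root, rather than bounding it by \<open>1\<close>, lets the small masses of far layers
  enter the final estimate.\<close>

lemma (in prob_space) empirical_deviation:
  fixes X :: "nat \<Rightarrow> 'a \<Rightarrow> 'b::topological_space"
  assumes ind: "indep_vars (\<lambda>_. borel) X {..<n}" and n: "1 \<le> n"
    and dist: "\<And>i. i < n \<Longrightarrow> distr M borel (X i) = \<mu>" and A[measurable]: "A \<in> sets borel"
  defines "Z \<equiv> \<lambda>\<omega>. \<Sum>i<n. indicator A (X i \<omega>) / real n"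
  shows "integrable M Z" "expectation Z = measure \<mu> A"
    "expectation (\<lambda>\<omega>. \<bar>measure \<mu> A - Z \<omega>\<bar>) \<le> sqrt (measure \<mu> A / real n)"
proof -
  define a where "a = measure \<mu> A"
  have Xm[measurable]: "X i \<in> measurable M borel" if "i < n" for i
    using ind that unfolding indep_vars_def by auto
  have meas: "prob (X i -` A \<inter> space M) = a" if "i < n" for i
    unfolding a_def dist[OF that, symmetric] by (rule measure_distr[symmetric]) (use Xm that in auto)
  define I where "I i \<omega> = (indicator A (X i \<omega>) :: real)" for i \<omega>
  have Im[measurable]: "I i \<in> borel_measurable M" if "i < n" for i
    unfolding I_def using Xm[OF that] by measurable
  have EI: "expectation (I i) = a" if "i < n" for i
  proof -
    have "expectation (I i) = expectation (indicator (X i -` A \<inter> space M))"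
      unfolding I_def by (intro Bochner_Integration.integral_cong) (auto simp: indicator_def)
    then show ?thesis using meas[OF that] by simp
  qed
  have Ii: "integrable M (I i)" if "i < n" for i
    by (rule integrable_const_bound[where B=1]) (use Im that in \<open>auto simp: I_def\<close>)
  show Zi: "integrable M Z" unfolding Z_def I_def[symmetric]
    by (intro Bochner_Integration.integrable_sum integrable_divide_zero Ii) auto
  show "expectation Z = measure \<mu> A"
  proof -
    have "expectation Z = (\<Sum>i<n. expectation (I i) / real n)"
      unfolding Z_def I_def[symmetric] using Ii by simp
    then show ?thesis using EI n by (simp add: a_def)
  qed
  \<comment> \<open>\<open>\<mu>\<close> is given here only as the law of the samples, so the bounds
    come from sample \<open>0\<close>, which exists since \<open>1 \<le> n\<close>.\<close>
  have a01: "0 \<le> a" "a \<le> 1"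
    using meas[of 0] n prob_le_1[of "X 0 -` A \<inter> space M"] measure_nonneg[of M "X 0 -` A \<inter> space M"] by auto
  have "indep_vars (\<lambda>_. borel) (\<lambda>i \<omega>. indicator A (X i \<omega>) - a) {..<n}"
    by (rule indep_vars_compose2[OF ind]) measurable
  then have ind': "indep_vars (\<lambda>_. borel) (\<lambda>i \<omega>. I i \<omega> - a) {..<n}" unfolding I_def .
  have "expectation (\<lambda>\<omega>. \<bar>\<Sum>i<n. I i \<omega> - a\<bar>) \<le> sqrt (real n * a)"
  proof (rule expectation_abs_sum_indep_le[OF ind' a01(1)])
    show "\<bar>I i \<omega> - a\<bar> \<le> 1" for i \<omega> using a01 by (auto simp: I_def indicator_def)
    show "expectation (\<lambda>\<omega>. I i \<omega> - a) = 0" if "i < n" for i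
      using Ii[OF that] EI[OF that] by (simp add: prob_space)
    show "expectation (\<lambda>\<omega>. (I i \<omega> - a)\<^sup>2) \<le> a" if "i < n" for i
    proof -
      \<comment> \<open>An indicator equals its square, so the expression is affine in it.\<close>
      have "(I i \<omega> - a)\<^sup>2 = (1 - 2 * a) * I i \<omega> + a\<^sup>2" for \<omega>
        by (auto simp: I_def indicator_def power2_eq_square algebra_simps)
      then have "expectation (\<lambda>\<omega>. (I i \<omega> - a)\<^sup>2) = (1 - 2 * a) * a + a\<^sup>2"
        using Ii[OF that] EI[OF that] by (simp add: prob_space)
      also have "(1 - 2 * a) * a + a\<^sup>2 \<le> a" by (simp add: power2_eq_square algebra_simps)
      finally show ?thesis .
    qed
  qed
  moreover have "\<bar>a - Z \<omega>\<bar> = \<bar>\<Sum>i<n. I i \<omega> - a\<bar> / real n" for \<omega>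
  proof -
    have "(\<Sum>i<n. I i \<omega> - a) / real n = Z \<omega> - a"
      unfolding Z_def I_def using n by (simp add: sum_subtractf sum_divide_distrib[symmetric] field_simps)
    then show ?thesis by (metis abs_divide abs_minus_commute abs_of_nat)
  qed
  ultimately have "expectation (\<lambda>\<omega>. \<bar>a - Z \<omega>\<bar>) \<le> sqrt (real n * a) / real n"
    using n by (simp add: divide_right_mono)
  also have "\<dots> = sqrt (a / real n)"
    using n by (simp add: real_sqrt_mult real_sqrt_divide field_simps)
  finally show "expectation (\<lambda>\<omega>. \<bar>measure \<mu> A - Z \<omega>\<bar>) \<le> sqrt (measure \<mu> A / real n)" unfolding a_def .
qed

lemma cell_mass_1:
  assumes "Measurable.pred \<mu> P"
  shows "cell_mass \<mu> (\<lambda>_. 1) P = measure \<mu> {y \<in> space \<mu>. P y}"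
proof -
  have "cell_mass \<mu> (\<lambda>_. 1) P = (\<integral>y. indicator {y \<in> space \<mu>. P y} y \<partial>\<mu>)"
    unfolding cell_mass_def by (intro Bochner_Integration.integral_cong) auto
  then show ?thesis using assms by simp
qed

text \<open>Cauchy-Schwarz against the constant \<open>1\<close>: for a fixed total mass,
  \<open>N\<close> cells cost a factor \<open>sqrt N\<close> only.\<close>

lemma sum_sqrt_le:
  fixes a :: "nat \<Rightarrow> real"
  assumes "\<And>k. k < N \<Longrightarrow> 0 \<le> a k"
  shows "(\<Sum>k<N. sqrt (a k)) \<le> sqrt (real N * (\<Sum>k<N. a k))"
proof (rule real_le_rsqrt)
  have "(\<Sum>k<N. 1 * sqrt (a k))\<^sup>2 \<le> (\<Sum>k<N. 1\<^sup>2) * (\<Sum>k<N. (sqrt (a k))\<^sup>2)"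
    by (rule Cauchy_Schwarz_ineq_sum)
  also have "(\<Sum>k<N. (sqrt (a k))\<^sup>2) = (\<Sum>k<N. a k)" using assms by (intro sum.cong) auto
  finally show "(\<Sum>k<N. sqrt (a k))\<^sup>2 \<le> real N * (\<Sum>k<N. a k)" by simp
qed

text \<open>\<open>outer_expectation\<close> asks for a majorant everywhere. Raising
  \<open>F\<close> to infinity on a null set provides one without changing the integral. This serves
  samples that lie in \<open>Y\<close> only almost surely.\<close>

lemma outer_expectation_le_AE:
  assumes "AE \<omega> in M. h \<omega> \<le> F \<omega>" and [measurable]: "F \<in> borel_measurable M"
  shows "outer_expectation M h \<le> (\<integral>\<^sup>+\<omega>. F \<omega> \<partial>M)"
proof -
  obtain E where E: "{\<omega> \<in> space M. \<not> h \<omega> \<le> F \<omega>} \<subseteq> E" "emeasure M E = 0" and [measurable]: "E \<in> sets M"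
    using AE_E[OF assms(1)] by auto
  have "AE \<omega> in M. \<omega> \<notin> E" by (rule AE_not_in) (use E in auto)
  then have "AE \<omega> in M. (if \<omega> \<in> E then \<infinity> else F \<omega>) = F \<omega>" by eventually_elim simp
  then have "(\<integral>\<^sup>+\<omega>. (if \<omega> \<in> E then \<infinity> else F \<omega>) \<partial>M) = (\<integral>\<^sup>+\<omega>. F \<omega> \<partial>M)"
    by (rule nn_integral_cong_AE)
  moreover have "outer_expectation M h \<le> (\<integral>\<^sup>+\<omega>. (if \<omega> \<in> E then \<infinity> else F \<omega>) \<partial>M)"
    unfolding outer_expectation_def by (rule INF_lower) (use E in auto)
  ultimately show ?thesis by simp
qed

text \<open>The transport starts from the density \<open>1\<close> and the weights
  \<open>1 / n\<close>. Its cost bound is a measurable function of the samples, and its expectation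
  is taken term by term.\<close>

lemma (in multiscale_partition) outer_expectation_wasserstein_le:
  fixes M :: "'b measure" and X :: "nat \<Rightarrow> 'b \<Rightarrow> 'a"
  assumes \<mu>: "prob_space \<mu>" and M: "prob_space M" and n: "1 \<le> n"
    and ind: "prob_space.indep_vars M (\<lambda>_. borel) X {..<n}"
    and dist: "\<And>i. i < n \<Longrightarrow> distr M borel (X i) = \<mu>"
  shows "outer_expectation M (\<lambda>\<omega>. wasserstein p (empirical_measure n (\<lambda>i. X i \<omega>)) \<mu> epowr p)
    \<le> (\<Sum>j. ennreal (R j powr p) * ennreal (scale_weight K * (2 * measure \<mu> {y. J y = j}) +
        (\<Sum>l<K. scale_weight l * min (2 * measure \<mu> {y. J y = j})
          (sqrt (real (N l) * measure \<mu> {y. J y = j} / real n)))))"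
proof -
  interpret P: prob_space \<mu> by fact
  interpret M: prob_space M by fact
  have sp: "space \<mu> = UNIV" using sets_eq_imp_space_eq[OF sets_mu] by simp
  have Xm[measurable]: "X i \<in> measurable M borel" if "i < n" for i
    using ind that unfolding M.indep_vars_def by auto
  have Jeq[measurable]: "Measurable.pred \<mu> (\<lambda>y. J y = j)" for j
    by (rule measurable_compose[OF J_meas]) simp
  have Teq[measurable]: "Measurable.pred \<mu> (\<lambda>y. T l y = i)" if "l < K" for l i
    by (rule measurable_compose[OF T_meas[OF that]]) simp
  have bor: "{y. P y} \<in> sets borel" if "Measurable.pred \<mu> P" for P
  proof -
    have "{y \<in> space \<mu>. P y} \<in> sets \<mu>" using that by measurable
    then show ?thesis by (simp add: sp sets_mu)
  qed
  define w where "w i = 1 / real n" for i :: nat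
  define x where "x \<omega> i = X i \<omega>" for \<omega> i
  define a where "a j = measure \<mu> {y. J y = j}" for j
  define b where "b j \<omega> = atom_mass n (x \<omega>) w (\<lambda>y. J y = j)" for j \<omega>
  define D where "D l j \<omega> = discrepancy (\<lambda>_. 1) n (x \<omega>) w l j" for l j \<omega>
  define q where "q l j k = measure \<mu> {y. J y = j \<and> T l y = k}" for l j k
  define Z where "Z l j k \<omega> = (\<Sum>i<n. indicator {y. J y = j \<and> T l y = k} (X i \<omega>) / real n)" for l j k \<omega>
  have b_eq: "b j \<omega> = (\<Sum>i<n. indicator {y. J y = j} (X i \<omega>) / real n)" for j \<omega>
    unfolding b_def atom_mass_def x_def w_def by (intro sum.cong) auto
  have D_eq: "D l j \<omega> = (\<Sum>k<N l. \<bar>q l j k - Z l j k \<omega>\<bar>)" if "l < K" for l j \<omega>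
    unfolding D_def discrepancy_def
  proof (intro sum.cong refl arg_cong[where f=abs] arg_cong2[where f="(-)"])
    fix k
    show "cell_mass \<mu> (\<lambda>_. 1) (\<lambda>y. J y = j \<and> T l y = k) = q l j k"
      unfolding q_def by (subst cell_mass_1) (use Jeq Teq[OF that] in \<open>auto simp: sp\<close>)
    show "atom_mass n (x \<omega>) w (\<lambda>y. J y = j \<and> T l y = k) = Z l j k \<omega>"
      unfolding Z_def atom_mass_def x_def w_def by (intro sum.cong) auto
  qed
  have a_cell: "cell_mass \<mu> (\<lambda>_. 1) (\<lambda>y. J y = j) = a j" for j
    unfolding a_def by (subst cell_mass_1) (auto simp: sp)
  have q_sum: "(\<Sum>k<N l. q l j k) = a j" if "l < K" for l j
  proof -
    have "a j = (\<Sum>k<N l. cell_mass \<mu> (\<lambda>_. 1) (\<lambda>y. J y = j \<and> T l y = k))"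
      unfolding a_cell[symmetric]
      by (rule cell_mass_split[OF T_meas[OF that] J_meas _ _ _ T_less[OF that]]) auto
    also have "\<dots> = (\<Sum>k<N l. q l j k)"
      unfolding q_def by (intro sum.cong refl, subst cell_mass_1) (use Jeq Teq[OF that] in \<open>auto simp: sp\<close>)
    finally show ?thesis ..
  qed
  have q0: "0 \<le> q l j k" for l j k unfolding q_def by simp
  have a0: "0 \<le> a j" for j unfolding a_def by simp
  have b0: "0 \<le> b j \<omega>" for j \<omega> unfolding b_eq by (intro sum_nonneg) auto
  have Z0: "0 \<le> Z l j k \<omega>" for l j k \<omega> unfolding Z_def by (intro sum_nonneg) auto
  note dev = M.empirical_deviation[OF ind n dist]
  have bi: "integrable M (b j)" and Eb: "M.expectation (b j) = a j" for j
    using dev(1,2)[OF _ bor[OF Jeq]] unfolding b_eq[abs_def] a_def by auto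
  have cell: "{y. J y = j \<and> T l y = k} \<in> sets borel" if "l < K" for l j k
    using Jeq Teq[OF that] by (intro bor) simp
  have Zi: "integrable M (Z l j k)" and EZ: "M.expectation (Z l j k) = q l j k"
    and EZd: "M.expectation (\<lambda>\<omega>. \<bar>q l j k - Z l j k \<omega>\<bar>) \<le> sqrt (q l j k / real n)" if "l < K" for l j k
    using dev[OF _ cell[OF that]] unfolding Z_def[abs_def] q_def by auto
  have Zdi: "integrable M (\<lambda>\<omega>. \<bar>q l j k - Z l j k \<omega>\<bar>)" if "l < K" for l j k
    using Zi[OF that] by simp
  have Di: "integrable M (D l j)" if "l < K" for l j
    unfolding D_eq[OF that, abs_def] using Zdi[OF that] by (intro Bochner_Integration.integrable_sum) auto
  have D0: "0 \<le> D l j \<omega>" for l j \<omega> unfolding D_def discrepancy_def by (intro sum_nonneg) auto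
  have ED_sum: "M.expectation (D l j) = (\<Sum>k<N l. M.expectation (\<lambda>\<omega>. \<bar>q l j k - Z l j k \<omega>\<bar>))" if "l < K" for l j
    unfolding D_eq[OF that, abs_def] using Zdi[OF that] by (intro Bochner_Integration.integral_sum) auto
  \<comment> \<open>The first bound is the triangle inequality in each cell, where
    \<open>q + Z\<close> has mean \<open>2 * q\<close>. The second sums the deviation estimates over
    the \<open>N l\<close> cells by Cauchy-Schwarz.\<close>
  have ED: "M.expectation (D l j) \<le> min (2 * a j) (sqrt (real (N l) * a j / real n))" if "l < K" for l j
  proof (rule min.boundedI)
    have "M.expectation (\<lambda>\<omega>. \<bar>q l j k - Z l j k \<omega>\<bar>) \<le> 2 * q l j k" for k
    proof -
      have "M.expectation (\<lambda>\<omega>. \<bar>q l j k - Z l j k \<omega>\<bar>) \<le> M.expectation (\<lambda>\<omega>. q l j k + Z l j k \<omega>)"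
      proof (intro integral_mono Zdi[OF that])
        show "\<bar>q l j k - Z l j k \<omega>\<bar> \<le> q l j k + Z l j k \<omega>" for \<omega> using q0[of l j k] Z0[of l j k \<omega>] by linarith
      qed (use Zi[OF that] in auto)
      also have "\<dots> = 2 * q l j k" using Zi[OF that] EZ[OF that] by (simp add: M.prob_space)
      finally show ?thesis .
    qed
    then have "M.expectation (D l j) \<le> (\<Sum>k<N l. 2 * q l j k)" unfolding ED_sum[OF that] by (rule sum_mono)
    then show "M.expectation (D l j) \<le> 2 * a j" by (simp add: sum_distrib_left[symmetric] q_sum[OF that])
    have "M.expectation (D l j) \<le> (\<Sum>k<N l. sqrt (q l j k / real n))"
      unfolding ED_sum[OF that] by (intro sum_mono EZd that)
    also have "\<dots> \<le> sqrt (real (N l) * (\<Sum>k<N l. q l j k / real n))"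
      by (rule sum_sqrt_le) (use q0 in auto)
    also have "(\<Sum>k<N l. q l j k / real n) = a j / real n"
      by (simp add: sum_divide_distrib[symmetric] q_sum[OF that])
    finally show "M.expectation (D l j) \<le> sqrt (real (N l) * a j / real n)" by simp
  qed
  have sw0: "0 \<le> scale_weight l" for l unfolding scale_weight_def by simp
  \<comment> \<open>\<open>a j + b j \<omega>\<close> plays the role of \<open>B j\<close>: it
    dominates the mass of layer \<open>j\<close> under both measures and has mean
    \<open>2 * a j\<close>.\<close>
  define G where "G j \<omega> = scale_weight K * (a j + b j \<omega>) + (\<Sum>l<K. scale_weight l * D l j \<omega>)" for j \<omega>
  have G0: "0 \<le> G j \<omega>" for j \<omega>
    unfolding G_def by (intro add_nonneg_nonneg mult_nonneg_nonneg sum_nonneg sw0 a0 b0 D0)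
  have Gi: "integrable M (G j)" for j
    unfolding G_def using bi Di by (intro Bochner_Integration.integrable_add Bochner_Integration.integrable_sum
      integrable_mult_right) auto
  have EG: "M.expectation (G j) \<le> scale_weight K * (2 * a j) +
      (\<Sum>l<K. scale_weight l * min (2 * a j) (sqrt (real (N l) * a j / real n)))" for j
  proof -
    have "M.expectation (G j) = scale_weight K * (2 * a j) + (\<Sum>l<K. scale_weight l * M.expectation (D l j))"
      unfolding G_def using bi Di Eb[of j]
      by (subst Bochner_Integration.integral_add)
        (auto simp: M.prob_space Bochner_Integration.integral_sum intro!: Bochner_Integration.integrable_sum)
    also have "\<dots> \<le> scale_weight K * (2 * a j) +
      (\<Sum>l<K. scale_weight l * min (2 * a j) (sqrt (real (N l) * a j / real n)))"
      by (intro add_mono sum_mono mult_left_mono ED sw0) auto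
    finally show ?thesis .
  qed
  \<comment> \<open>\<open>F\<close> is the measurable majorant of the possibly non-measurable
    Wasserstein term.\<close>
  define F where "F \<omega> = (\<Sum>j. ennreal (R j powr p) * ennreal (G j \<omega>))" for \<omega>
  have Gm[measurable]: "G j \<in> borel_measurable M" for j using Gi by auto
  have Fm: "F \<in> borel_measurable M" unfolding F_def by measurable
  have "AE \<omega> in M. \<forall>i\<in>{..<n}. X i \<omega> \<in> Y"
  proof (rule AE_finite_allI)
    fix i assume "i \<in> {..<n}"
    then have i: "i < n" by simp
    have "AE y in distr M borel (X i). y \<in> Y" unfolding dist[OF i] by (rule AE_Y)
    then show "AE \<omega> in M. X i \<omega> \<in> Y" by (rule AE_distrD[OF Xm[OF i]])
  qed simp
  then have "AE \<omega> in M. wasserstein p (empirical_measure n (\<lambda>i. X i \<omega>)) \<mu> epowr p \<le> F \<omega>"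
  proof eventually_elim
    case (elim \<omega>)
    have mass: "cell_mass \<mu> (\<lambda>_. 1) (\<lambda>_. True) = atom_mass n (x \<omega>) w (\<lambda>_. True)"
      unfolding cell_mass_def atom_mass_def w_def using n by (simp add: P.prob_space)
    have "\<exists>f. (\<forall>i. f i \<in> borel_measurable \<mu>) \<and> (\<forall>i y. 0 \<le> f i y) \<and>
      (AE y in \<mu>. (\<Sum>i<n. f i y) = 1) \<and>
      (\<forall>i<n. (\<integral>\<^sup>+y. ennreal (f i y) \<partial>\<mu>) = ennreal (w i)) \<and>
      (\<Sum>i<n. \<integral>\<^sup>+y. ennreal (norm (x \<omega> i - y) powr p * f i y) \<partial>\<mu>) \<le>
      (\<Sum>j. ennreal (R j powr p) * ennreal (scale_weight K * (a j + b j \<omega>) +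
        (\<Sum>l<K. scale_weight l * discrepancy (\<lambda>_. 1) n (x \<omega>) w l j)))"
    proof (rule multiscale_transport[OF order_refl _ _ _ _ _ mass])
      show "x \<omega> i \<in> Y" if "i < n" for i using elim that unfolding x_def by simp
      show "cell_mass \<mu> (\<lambda>_. 1) (\<lambda>y. J y = j) \<le> a j + b j \<omega>" for j
        using b0[of j \<omega>] unfolding a_cell by simp
      show "atom_mass n (x \<omega>) w (\<lambda>y. J y = j) \<le> a j + b j \<omega>" for j
        using a0[of j] unfolding b_def by simp
      show "0 \<le> w i" for i unfolding w_def by simp
    qed auto
    then obtain f where f: "\<And>i. f i \<in> borel_measurable \<mu>" "AE y in \<mu>. (\<Sum>i<n. f i y) = 1" "\<And>i y. 0 \<le> f i y"
      "\<And>i. i < n \<Longrightarrow> (\<integral>\<^sup>+y. ennreal (f i y) \<partial>\<mu>) = ennreal (1 / real n)"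
      and cost: "(\<Sum>i<n. \<integral>\<^sup>+y. ennreal (norm (x \<omega> i - y) powr p * f i y) \<partial>\<mu>) \<le> F \<omega>"
      unfolding F_def G_def D_def w_def by blast
    have "wasserstein p (empirical_measure n (x \<omega>)) \<mu> epowr p \<le>
      (\<Sum>i<n. \<integral>\<^sup>+y. ennreal (norm (x \<omega> i - y) powr p * f i y) \<partial>\<mu>)"
      by (rule wasserstein_le_transport[OF \<mu> sets_mu n _ f]) (use p_ge in auto)
    with cost show ?case unfolding x_def by (rule order_trans[rotated])
  qed
  then have "outer_expectation M (\<lambda>\<omega>. wasserstein p (empirical_measure n (\<lambda>i. X i \<omega>)) \<mu> epowr p)
    \<le> (\<integral>\<^sup>+\<omega>. F \<omega> \<partial>M)"
    by (rule outer_expectation_le_AE[OF _ Fm])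
  also have "\<dots> = (\<Sum>j. \<integral>\<^sup>+\<omega>. ennreal (R j powr p) * ennreal (G j \<omega>) \<partial>M)"
    unfolding F_def by (rule nn_integral_suminf) measurable
  also have "\<dots> = (\<Sum>j. ennreal (R j powr p) * ennreal (M.expectation (G j)))"
    by (intro suminf_cong) (simp add: nn_integral_cmult nn_integral_eq_integral[OF Gi] G0)
  also have "\<dots> \<le> (\<Sum>j. ennreal (R j powr p) * ennreal (scale_weight K * (2 * a j) +
      (\<Sum>l<K. scale_weight l * min (2 * a j) (sqrt (real (N l) * a j / real n)))))"
    by (intro suminf_le mult_left_mono ennreal_leI EG) auto
  finally show ?thesis unfolding a_def .
qed

section \<open>Nested partitions from coverings\<close>

text \<open>A finite infimum means that the set of admissible sizes is nonempty, and a nonempty set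
  in \<open>enat\<close> contains its infimum; hence an optimal cover exists.\<close>

lemma covering_number_finiteE:
  assumes "covering_number \<epsilon> B = enat N"
  obtains c where "0 < N" "\<And>i. i < N \<Longrightarrow> c i \<in> B" "\<And>u. u \<in> B \<Longrightarrow> \<exists>i<N. norm (u - c i) \<le> \<epsilon>"
proof -
  define S where "S = {enat N | N. 0 < N \<and>
     (\<exists>x :: nat \<Rightarrow> 'a. (\<forall>i<N. x i \<in> B) \<and> B \<subseteq> (\<Union>i<N. {y. norm (y - x i) \<le> \<epsilon>}))}"
  have S: "Inf S = enat N" using assms unfolding covering_number_def S_def .
  then have "S \<noteq> {}" by (auto simp: Inf_enat_def)
  then have "(LEAST x. x \<in> S) \<in> S" by (auto intro: LeastI)
  with S \<open>S \<noteq> {}\<close> have "enat N \<in> S" by (simp add: Inf_enat_def)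
  then obtain x where "0 < N" "\<forall>i<N. x i \<in> B" "B \<subseteq> (\<Union>i<N. {y. norm (y - x i) \<le> \<epsilon>})"
    unfolding S_def by auto
  then show thesis by (intro that[of x]) auto
qed

text \<open>Labels are built from the finest level to the coarsest: a cell passes on the coarser
  label of its own centre, which lies in \<open>B\<close> and so is covered at the coarser level
  too. Each label is thus a function of the next finer one, and level \<open>l\<close> still has at
  most \<open>N l\<close> cells; intersecting the partitions would multiply these numbers.\<close>

lemma nested_labels:
  fixes B :: "'a::real_normed_vector set" and N :: "nat \<Rightarrow> nat"
  assumes cov: "\<And>l. l < K \<Longrightarrow> covering_number (1 / 3 ^ (l + 1)) B = enat (N l)"
  obtains t :: "nat \<Rightarrow> 'a \<Rightarrow> nat"
  where "\<And>l. l < K \<Longrightarrow> t l \<in> measurable borel (count_space UNIV)"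
    "\<And>l u. l < K \<Longrightarrow> t l u < N l"
    "\<And>l u v. Suc l < K \<Longrightarrow> t (Suc l) u = t (Suc l) v \<Longrightarrow> t l u = t l v"
    "\<And>l u v. l < K \<Longrightarrow> u \<in> B \<Longrightarrow> v \<in> B \<Longrightarrow> t l u = t l v \<Longrightarrow> norm (u - v) \<le> 1 / 3 ^ l"
proof -
  have "\<exists>c. 0 < N l \<and> (\<forall>i<N l. c i \<in> B) \<and> (\<forall>u\<in>B. \<exists>i<N l. norm (u - c i) \<le> 1 / 3 ^ (l + 1))" if "l < K" for l
    using covering_number_finiteE[OF cov[OF that]] by metis
  then obtain c where N0: "\<And>l. l < K \<Longrightarrow> 0 < N l" and cB: "\<And>l i. l < K \<Longrightarrow> i < N l \<Longrightarrow> c l i \<in> B"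
    and cov': "\<And>l u. l < K \<Longrightarrow> u \<in> B \<Longrightarrow> \<exists>i<N l. norm (u - c l i) \<le> 1 / 3 ^ (l + 1)"
    by metis
  define near where "near l u i \<longleftrightarrow> i < N l \<and> norm (u - c l i) \<le> 1 / 3 ^ (l + 1)" for l u i
  \<comment> \<open>Taking the first admissible centre makes the choice measurable. At the levels in
    use, only points outside \<open>B\<close> can be near no centre; their label \<open>0\<close> is
    legal because \<open>0 < N l\<close>.\<close>
  define a where "a l u = (if \<exists>i. near l u i then LEAST i. near l u i else 0)" for l u
  have near_m[measurable]: "Measurable.pred borel (\<lambda>u. near l u i)" for l i
  proof -
    have [measurable]: "(\<lambda>u. norm (u - c l i)) \<in> borel_measurable borel"
      by (intro borel_measurable_continuous_onI continuous_intros)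
    show ?thesis unfolding near_def by measurable
  qed
  have a_m: "a l \<in> measurable borel (count_space UNIV)" for l
    unfolding a_def by measurable
  have a_less: "a l u < N l" if "l < K" for l u
  proof (cases "\<exists>i. near l u i")
    case True
    from LeastI_ex[OF this] have "near l u (a l u)" using True by (simp add: a_def)
    then show ?thesis by (simp add: near_def)
  qed (simp add: a_def N0[OF that])
  have a_near: "norm (u - c l (a l u)) \<le> 1 / 3 ^ (l + 1)" if "l < K" "u \<in> B" for l u
  proof -
    have ex: "\<exists>i. near l u i" using cov'[OF that] unfolding near_def by blast
    then show ?thesis using LeastI_ex[OF ex] unfolding a_def near_def by simp
  qed
  \<comment> \<open>The radius \<open>1 / (2 * 3 ^ l)\<close> reproduces itself:
    \<open>1 / (2 * 3 ^ (l + 1))\<close> plus the covering radius \<open>1 / 3 ^ (l + 1)\<close>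
    equals it. Twice this radius is the wanted diameter.\<close>
  define nested where "nested l0 t \<longleftrightarrow> (\<forall>l\<in>{l0..<K}. t l \<in> measurable borel (count_space UNIV) \<and>
      (\<forall>u. t l u < N l) \<and> (Suc l < K \<longrightarrow> (\<forall>u v. t (Suc l) u = t (Suc l) v \<longrightarrow> t l u = t l v)) \<and>
      (\<forall>u\<in>B. norm (u - c l (t l u)) \<le> 1 / (2 * 3 ^ l)))" for l0 t
  have "\<exists>t. nested l0 t" if "l0 \<le> K" for l0
    using that
  proof (induction l0 rule: inc_induct)
    case base
    show ?case by (simp add: nested_def)
  next
    case (step k)
    obtain t where "nested (Suc k) t" using step.IH by blast
    note ok = bspec[OF this[unfolded nested_def], simplified atLeastLessThan_iff]
    have tm: "t l \<in> measurable borel (count_space UNIV)" if "Suc k \<le> l" "l < K" for l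
      using ok[of l] that by blast
    have tN: "t l u < N l" if "Suc k \<le> l" "l < K" for l u
      using ok[of l] that by blast
    have tn: "t l u = t l v" if "Suc k \<le> l" "Suc l < K" "t (Suc l) u = t (Suc l) v" for l u v
      using ok[of l] that(1,3) Suc_lessD[OF that(2)] that(2) by blast
    have te: "norm (u - c l (t l u)) \<le> 1 / (2 * 3 ^ l)" if "Suc k \<le> l" "l < K" "u \<in> B" for l u
      using ok[of l] that by blast
    \<comment> \<open>The finest level, where \<open>Suc k = K\<close>, labels the point itself
      instead of a finer centre.\<close>
    define s where "s u = (if Suc k < K then a k (c (Suc k) (t (Suc k) u)) else a k u)" for u
    have sm: "s \<in> measurable borel (count_space UNIV)"
    proof (cases "Suc k < K")
      case True
      have "(\<lambda>u. a k (c (Suc k) (t (Suc k) u))) \<in> measurable borel (count_space UNIV)"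
        by (rule measurable_compose[OF tm[OF _ True]]) simp_all
      with True show ?thesis by (simp add: s_def[abs_def])
    qed (simp add: s_def[abs_def] a_m)
    have sN: "s u < N k" for u unfolding s_def using a_less step.hyps by simp
    have se: "norm (u - c k (s u)) \<le> 1 / (2 * 3 ^ k)" if u: "u \<in> B" for u
    proof (cases "Suc k < K")
      case True
      define v where "v = c (Suc k) (t (Suc k) u)"
      have "v \<in> B" unfolding v_def by (rule cB[OF True tN[OF _ True]]) simp
      then have "norm (v - c k (a k v)) \<le> 1 / 3 ^ (k + 1)" using a_near step.hyps by blast
      moreover have "norm (u - v) \<le> 1 / (2 * 3 ^ Suc k)" unfolding v_def by (rule te[OF _ True u]) simp
      moreover have "norm (u - c k (a k v)) \<le> norm (u - v) + norm (v - c k (a k v))"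
        using norm_triangle_ineq[of "u - v" "v - c k (a k v)"] by simp
      ultimately have "norm (u - c k (a k v)) \<le> 1 / (2 * 3 ^ Suc k) + 1 / 3 ^ (k + 1)" by linarith
      also have "\<dots> = 1 / (2 * 3 ^ k)" by (simp add: field_simps)
      finally show ?thesis using True unfolding s_def v_def by simp
    next
      case False
      have "norm (u - c k (a k u)) \<le> 1 / 3 ^ (k + 1)" using a_near u step.hyps by blast
      also have "\<dots> \<le> 1 / (2 * 3 ^ k)" by (simp add: field_simps)
      finally show ?thesis using False unfolding s_def by simp
    qed
    show ?case
      unfolding nested_def
    proof (intro exI[of _ "t(k := s)"] ballI conjI impI allI)
      fix l assume "l \<in> {k..<K}"
      then have l: "l = k \<or> Suc k \<le> l" "l < K" by auto
      show "(t(k := s)) l \<in> measurable borel (count_space UNIV)" using sm tm l by auto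
      show "(t(k := s)) l u < N l" for u using sN tN l by auto
      show "norm (u - c l ((t(k := s)) l u)) \<le> 1 / (2 * 3 ^ l)" if "u \<in> B" for u
        using se te l that by auto
      show "(t(k := s)) l u = (t(k := s)) l v"
        if "Suc l < K" "(t(k := s)) (Suc l) u = (t(k := s)) (Suc l) v" for u v
        using l(1)
      proof
        assume "l = k"
        then show ?thesis using that by (simp add: s_def)
      next
        assume "Suc k \<le> l"
        then show ?thesis using that tn[of l u v] by simp
      qed
    qed
  qed
  from this[of 0] obtain t where "nested 0 t" by blast
  note ok = bspec[OF this[unfolded nested_def], simplified atLeastLessThan_iff]
  show thesis
  proof (rule that[of t])
    show "t l \<in> measurable borel (count_space UNIV)" if "l < K" for l
      using ok[of l] that le0 by blast
    show "t l u < N l" if "l < K" for l u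
      using ok[of l] that le0 by blast
    show "t l u = t l v" if "Suc l < K" "t (Suc l) u = t (Suc l) v" for l u v
      using ok[of l] that(2) Suc_lessD[OF that(1)] that(1) le0 by blast
  next
    fix l u v assume l: "l < K" and u: "u \<in> B" and v: "v \<in> B" and eq: "t l u = t l v"
    have te: "\<forall>u\<in>B. norm (u - c l (t l u)) \<le> 1 / (2 * 3 ^ l)" using ok[of l] l le0 by blast
    have "norm (u - v) \<le> norm (u - c l (t l u)) + norm (v - c l (t l u))"
      using norm_triangle_ineq4[of "u - c l (t l u)" "v - c l (t l u)"] by simp
    also have "\<dots> \<le> 1 / (2 * 3 ^ l) + 1 / (2 * 3 ^ l)"
      using te u v eq by (intro add_mono) auto
    also have "\<dots> = 1 / 3 ^ l" by (simp add: field_simps)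
    finally show "norm (u - v) \<le> 1 / 3 ^ l" .
  qed
qed

section \<open>Markov bound for the layers and the admissible constant\<close>

lemma markov_layer:
  fixes \<rho> :: "'a \<Rightarrow> ennreal"
  assumes \<mu>: "prob_space \<mu>" and [measurable]: "\<rho> \<in> borel_measurable \<mu>" and q: "0 < q" and m: "0 < m"
    and moment: "(\<integral>\<^sup>+x. \<rho> x epowr q \<partial>\<mu>) = ennreal (m powr q)"
    and t: "0 < t" and A: "A \<in> sets \<mu>" "\<And>x. x \<in> A \<Longrightarrow> ennreal (t * m) \<le> \<rho> x"
  shows "measure \<mu> A \<le> t powr - q"
proof -
  interpret prob_space \<mu> by fact
  have "ennreal ((t * m) powr q) * emeasure \<mu> A = (\<integral>\<^sup>+x. ennreal ((t * m) powr q) * indicator A x \<partial>\<mu>)"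
    using A by (simp add: nn_integral_cmult_indicator)
  also have "\<dots> \<le> (\<integral>\<^sup>+x. \<rho> x epowr q \<partial>\<mu>)"
  proof (rule nn_integral_mono)
    fix x
    have "ennreal ((t * m) powr q) \<le> \<rho> x epowr q" if "x \<in> A"
      using epowr_mono[OF A(2)[OF that], of q] q m t by (simp add: epowr_ennreal)
    then show "ennreal ((t * m) powr q) * indicator A x \<le> \<rho> x epowr q" by (auto simp: indicator_def)
  qed
  also have "\<dots> = ennreal (m powr q)" by (rule moment)
  finally have "(t * m) powr q * measure \<mu> A \<le> m powr q"
    by (simp add: emeasure_eq_measure ennreal_mult[symmetric])
  then have "t powr q * measure \<mu> A \<le> 1" using m t by (simp add: powr_mult field_simps)
  then show ?thesis using t by (simp add: powr_minus field_simps)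
qed

text \<open>The factor \<open>2\<close> is absorbed into \<open>25 powr p\<close>, using
  \<open>1 \<le> p\<close>, and \<open>25 * 4 = 100\<close>.\<close>

lemma wasserstein_const_ge:
  assumes "1 \<le> p" "p < q"
  shows "2 * 4 powr p * 2 powr q \<le> wasserstein_const p q"
proof -
  have "(2::real) powr 1 * 4 powr p * 2 powr q \<le> 25 powr p * 4 powr p * 100 powr q"
    using assms by (intro mult_mono order_trans[OF powr_mono[of 1 p 2] powr_mono2] powr_mono2) auto
  also have "\<dots> = wasserstein_const p q"
    by (simp add: wasserstein_const_def powr_add powr_mult[symmetric])
  finally show ?thesis by simp
qed

section \<open>Dyadic layers and the final estimate\<close>

theorem theorem2p3:
  fixes \<rho> :: "'a::banach \<Rightarrow> ennreal"
    and \<mu> :: "'a measure"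
    and M :: "'b measure"
    and X :: "nat \<Rightarrow> 'b \<Rightarrow> 'a"
    and p q :: real
    and Mq :: ennreal
    and n L :: nat
    and B0 :: "'a set"
    and Nbar :: "nat \<Rightarrow> ennreal"
  assumes rho_measurable: "\<rho> \<in> borel_measurable borel"
    and rho_homogeneous: "\<And>a x. \<rho> (a *\<^sub>R x) = ennreal \<bar>a\<bar> * \<rho> x"
    and B0_def: "B0 = {x. \<rho> x \<le> 1}"
    and B0_subset: "B0 \<subseteq> {x. norm x \<le> 1}"
    and Nbar_def: "\<And>l. Nbar l = ennreal_of_enat (covering_number (1 / 3 ^ (l + 1)) B0)"
    and p: "1 \<le> p" and q: "p < q"
    and mu: "prob_space \<mu>" "sets \<mu> = sets borel"
    and moment: "(\<integral>\<^sup>+x. \<rho> x epowr q \<partial>\<mu>) epowr (1 / q) = Mq" "Mq < \<infinity>"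
    and n: "1 \<le> n"
    and M: "prob_space M"
    and indep: "prob_space.indep_vars M (\<lambda>_. borel) X {..<n}"
    and distribution: "\<And>i. i < n \<Longrightarrow> distr M borel (X i) = \<mu>"
    and L: "1 \<le> L"
  shows "outer_expectation M
           (\<lambda>\<omega>. wasserstein p (empirical_measure n (\<lambda>i. X i \<omega>)) \<mu> epowr p)
         \<le> ennreal (wasserstein_const p q) * Mq epowr p *
           (\<Sum>j. ennreal (2 powr (p * real j)) *
             (ennreal (2 powr (- q * real j) * 3 powr (- p * real L)) +
              (\<Sum>l=0..L. ennreal (3 powr (- p * real l)) *
                 min (ennreal (2 powr (- q * real j)))
                     ((Nbar l * ennreal (2 powr (- q * real j)) / ennreal (real n)) epowr (1 / 2)))))"
proof -
  interpret P: prob_space \<mu> by (rule mu(1))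
  have q0: "0 < q" and p0: "0 < p" using p q by auto
  have sp: "space \<mu> = UNIV" using sets_eq_imp_space_eq[OF mu(2)] by simp
  have rho_m[measurable]: "\<rho> \<in> borel_measurable \<mu>"
    using rho_measurable by (simp add: measurable_cong_sets[OF mu(2) refl])
  define m where "m = enn2real Mq"
  have m0: "0 \<le> m" and Mq: "Mq = ennreal m" using moment(2) unfolding m_def by auto
  have moment': "(\<integral>\<^sup>+x. \<rho> x epowr q \<partial>\<mu>) = ennreal (m powr q)"
    using epowr_epowr_inverse[OF q0, of "\<integral>\<^sup>+x. \<rho> x epowr q \<partial>\<mu>"] m0 unfolding moment(1) Mq
    by (simp add: epowr_ennreal)
  have epm[measurable]: "(\<lambda>x. \<rho> x epowr q) \<in> borel_measurable \<mu>" unfolding epowr_def by measurable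
  show ?thesis
  proof (cases "m = 0")
    \<comment> \<open>With \<open>m = 0\<close> there is no unit for the layers. Then
      \<open>\<rho>\<close> vanishes almost surely, and by homogeneity all multiples of such a point
      lie in the bounded set \<open>B0\<close>, so the point is \<open>0\<close>. A single layer of
      radius \<open>0\<close> gives cost \<open>0\<close>.\<close>
    case True
    have "AE x in \<mu>. \<rho> x epowr q = 0"
      using moment' True by (simp add: nn_integral_0_iff_AE)
    then have AE0: "AE x in \<mu>. x \<in> {0}"
    proof eventually_elim
      case (elim x)
      then have r0: "\<rho> x = 0"
        by (auto simp: epowr_def enn2real_eq_0_iff split: if_splits)
      have "a *\<^sub>R x \<in> B0" for a
        using rho_homogeneous[of a x] by (simp add: B0_def r0)
      then have "norm (a *\<^sub>R x) \<le> 1" for a using B0_subset by blast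
      \<comment> \<open>For \<open>x \<noteq> 0\<close> this multiple would have norm
        \<open>2\<close>.\<close>
      from this[of "2 / norm x"] show ?case by (cases "x = 0") auto
    qed
    interpret multiscale_partition \<mu> "\<lambda>_. 0" "\<lambda>_ _. 0" "\<lambda>_. 1" "\<lambda>_. 0" "{0}" 0 p
      by unfold_locales (use mu(2) p AE0 in auto)
    show ?thesis
      using outer_expectation_wasserstein_le[OF mu(1) M n indep distribution] by simp
  next
    case False
    with m0 have m: "0 < m" by simp
    define R where "R j = 2 ^ j * m" for j :: nat
    have R0: "0 < R j" for j unfolding R_def using m by simp
    \<comment> \<open>Where \<open>\<rho>\<close> is infinite no \<open>j\<close> qualifies and
      \<open>LEAST\<close> would be unspecified. The value \<open>0\<close> is safe: the mass of
      layer \<open>0\<close> is only ever bounded by \<open>1\<close>.\<close>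
    define J where "J y = (if \<rho> y = \<infinity> then 0 else LEAST j. \<rho> y \<le> ennreal (R j))" for y
    define Y where "Y = {y. \<rho> y < \<infinity>}"
    have Jm[measurable]: "J \<in> measurable \<mu> (count_space UNIV)" unfolding J_def by measurable
    have J_le: "\<rho> y \<le> ennreal (R (J y))" if "y \<in> Y" for y
    proof -
      have "\<rho> y < \<infinity>" using that by (simp add: Y_def)
      then obtain r where r: "0 \<le> r" "\<rho> y = ennreal r" by (cases "\<rho> y") auto
      obtain j where "r / m < 2 ^ j" using real_arch_pow[of 2 "r / m"] by auto
      then have "\<rho> y \<le> ennreal (R j)" unfolding r R_def using m by (intro ennreal_leI) (simp add: field_simps)
      then have "\<rho> y \<le> ennreal (R (LEAST j. \<rho> y \<le> ennreal (R j)))" by (rule LeastI)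
      then show ?thesis using that unfolding J_def Y_def by auto
    qed
    have J_Suc: "ennreal (2 ^ i * m) \<le> \<rho> y" if "J y = Suc i" for y i
    proof -
      have "(LEAST j. \<rho> y \<le> ennreal (R j)) = Suc i" using that unfolding J_def by (auto split: if_splits)
      then have "\<not> \<rho> y \<le> ennreal (R i)" using not_less_Least[of i "\<lambda>j. \<rho> y \<le> ennreal (R j)"] by simp
      then show ?thesis unfolding R_def by simp
    qed
    define a where "a j = measure \<mu> {y. J y = j}" for j
    \<comment> \<open>Points of layer \<open>j = Suc i\<close> satisfy
      \<open>\<rho> y \<ge> 2 ^ i * m\<close>, one dyadic step below their radius; this step costs
      \<open>2 powr q\<close>, which also covers layer \<open>0\<close>.\<close>
    have a_le: "a j \<le> 2 powr q * 2 powr (- q * real j)" for j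
    proof (cases j)
      case 0
      have "a j \<le> 1" unfolding a_def by (rule P.prob_le_1)
      also have "1 \<le> (2::real) powr q" using q0 by (intro ge_one_powr_ge_zero) auto
      finally show ?thesis using 0 by simp
    next
      case (Suc i)
      have "a j \<le> (2 ^ i) powr - q"
        unfolding a_def
      proof (rule markov_layer[OF mu(1) rho_m q0 m moment'])
        have "{y \<in> space \<mu>. J y = j} \<in> sets \<mu>" by measurable
        then show "{y. J y = j} \<in> sets \<mu>" by (simp add: sp)
      qed (use J_Suc Suc in auto)
      also have "\<dots> = 2 powr q * 2 powr (- q * real j)"
        using Suc by (simp add: powr_realpow[symmetric] powr_powr powr_add[symmetric] algebra_simps)
      finally show ?thesis .
    qed
    have AE_Y: "AE y in \<mu>. y \<in> Y"
    proof -
      have "AE y in \<mu>. \<rho> y epowr q \<noteq> \<infinity>"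
        by (rule nn_integral_PInf_AE) (use moment' in auto)
      then show ?thesis by eventually_elim (auto simp: Y_def epowr_def less_top[symmetric])
    qed
    \<comment> \<open>Levels from the first infinite covering number on are not used: the corresponding term of the
      bound is already \<open>3 powr (- p * K) * 2 powr (- q * j)\<close>, the cost of the unresolved mass.\<close>
    define K where "K = (LEAST l. l = Suc L \<or> Nbar l = \<infinity>)"
    have K: "K = Suc L \<or> Nbar K = \<infinity>" unfolding K_def by (rule LeastI[of _ "Suc L"]) simp
    have K_le: "K \<le> Suc L" unfolding K_def by (rule Least_le) simp
    have K_fin: "Nbar l \<noteq> \<infinity>" if "l < K" for l
      using not_less_Least[of l "\<lambda>l. l = Suc L \<or> Nbar l = \<infinity>"] that unfolding K_def by blast
    define N where "N l = the_enat (covering_number (1 / 3 ^ (l + 1)) B0)" for l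
    have cov: "covering_number (1 / 3 ^ (l + 1)) B0 = enat (N l)" if "l < K" for l
      using K_fin[OF that] unfolding N_def Nbar_def by (cases "covering_number (1 / 3 ^ (l + 1)) B0") auto
    have Nbar: "Nbar l = of_nat (N l)" if "l < K" for l
      unfolding Nbar_def cov[OF that] by simp
    obtain t where tm: "\<And>l. l < K \<Longrightarrow> t l \<in> measurable borel (count_space UNIV)"
      and tN: "\<And>l u. l < K \<Longrightarrow> t l u < N l"
      and tn: "\<And>l u v. Suc l < K \<Longrightarrow> t (Suc l) u = t (Suc l) v \<Longrightarrow> t l u = t l v"
      and td: "\<And>l u v. l < K \<Longrightarrow> u \<in> B0 \<Longrightarrow> v \<in> B0 \<Longrightarrow> t l u = t l v \<Longrightarrow> norm (u - v) \<le> 1 / 3 ^ l"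
      using nested_labels[OF cov] by blast
    \<comment> \<open>Scaling by the radius of the layer, not by \<open>\<rho> y\<close>, multiplies
      all distances within a layer by the same factor and still lands in \<open>B0\<close>.\<close>
    define s where "s y = (1 / R (J y)) *\<^sub>R y" for y
    define T where "T l y = t l (s y)" for l y
    have s_B0: "s y \<in> B0" if "y \<in> Y" for y
    proof -
      have "\<rho> (s y) = ennreal (1 / R (J y)) * \<rho> y"
        unfolding s_def rho_homogeneous using R0[of "J y"] by simp
      also have "\<dots> \<le> ennreal (1 / R (J y)) * ennreal (R (J y))"
        by (intro mult_left_mono J_le that) simp
      also have "\<dots> = 1" using R0[of "J y"] by (simp add: ennreal_mult[symmetric])
      finally show ?thesis by (simp add: B0_def)
    qed
    interpret multiscale_partition \<mu> J T N R Y K p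
    proof unfold_locales
      show "sets \<mu> = sets borel" "J \<in> measurable \<mu> (count_space UNIV)" "AE y in \<mu>. y \<in> Y" "1 \<le> p"
        by fact+
      show "T l \<in> measurable \<mu> (count_space UNIV)" if "l < K" for l
        unfolding T_def s_def
      \<comment> \<open>For a fixed layer the scaling is continuous, and there are countably many
        layers.\<close>
      proof (rule measurable_compose_countable[OF _ Jm])
        fix j
        have "(\<lambda>y :: 'a. (1 / R j) *\<^sub>R y) \<in> measurable borel borel"
          by (intro borel_measurable_continuous_onI linear_continuous_on bounded_linear_scaleR_right)
        from measurable_compose[OF this tm[OF that]]
        show "(\<lambda>y. t l ((1 / R j) *\<^sub>R y)) \<in> measurable \<mu> (count_space UNIV)"
          by (simp add: measurable_cong_sets[OF mu(2) refl])
      qed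
      show "T l y < N l" if "l < K" for l y unfolding T_def by (rule tN[OF that])
      show "T l y = T l z" if "Suc l < K" "T (Suc l) y = T (Suc l) z" for l y z
        using tn that unfolding T_def by blast
      show "0 \<le> R j" for j using R0[of j] by simp
      show "norm y \<le> R (J y)" if "y \<in> Y" for y
      proof -
        have "norm (s y) \<le> 1" using s_B0[OF that] B0_subset by auto
        then show ?thesis unfolding s_def using R0[of "J y"] by (simp add: field_simps)
      qed
      show "norm (z - y) \<le> R (J y) / 3 ^ l"
        if "l < K" "y \<in> Y" "z \<in> Y" "J y = J z" "T l y = T l z" for l y z
      proof -
        have "norm (s z - s y) \<le> 1 / 3 ^ l"
          by (rule td) (use that s_B0 in \<open>auto simp: T_def\<close>)
        moreover have "s z - s y = (1 / R (J y)) *\<^sub>R (z - y)"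
          unfolding s_def that(4) by (simp add: scaleR_diff_right)
        ultimately have "norm (z - y) / R (J y) \<le> 1 / 3 ^ l" using R0[of "J y"] by simp
        then show ?thesis using R0[of "J y"] by (simp add: pos_divide_le_eq)
      qed
    qed
    \<comment> \<open>\<open>4 powr p\<close> comes from \<open>scale_weight\<close>,
      \<open>2 powr q\<close> from the bound on \<open>a j\<close>, and \<open>2\<close> from the
      doubled layer mass.\<close>
    define C where "C = 2 * 4 powr p * 2 powr q"
    have C0: "0 \<le> C" unfolding C_def by simp
    define \<tau> where "\<tau> j l = ennreal (3 powr (- p * real l)) *
      min (ennreal (2 powr (- q * real j))) ((Nbar l * ennreal (2 powr (- q * real j)) / ennreal (real n)) epowr (1 / 2))"
      for j l
    define E where "E j = ennreal (2 powr (- q * real j) * 3 powr (- p * real L)) + (\<Sum>l=0..L. \<tau> j l)" for j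
    have bound: "ennreal (scale_weight K * (2 * a j) +
        (\<Sum>l<K. scale_weight l * min (2 * a j) (sqrt (real (N l) * a j / real n)))) \<le> ennreal C * E j" for j
    proof -
      define v where "v = 2 powr (- q * real j)"
      have v0: "0 < v" unfolding v_def by simp
      have av: "a j \<le> 2 powr q * v" unfolding v_def by (rule a_le)
      have q1: "1 \<le> (2::real) powr q" using q0 by (intro ge_one_powr_ge_zero) auto
      define e where "e l = min v (sqrt (real (N l) * v / real n))" for l
      have e0: "0 \<le> e l" for l unfolding e_def using v0 by simp
      \<comment> \<open>Both arguments of the minimum get the same factor: the first one requires
        \<open>2 * 2 powr q\<close>, the second only \<open>sqrt (2 powr q)\<close>, which is
        smaller as \<open>2 powr q \<ge> 1\<close>.\<close>
      have min_le: "min (2 * a j) (sqrt (real (N l) * a j / real n)) \<le> 2 * 2 powr q * e l" for l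
      proof -
        have "sqrt (real (N l) * a j / real n) \<le> sqrt (2 powr q * (real (N l) * v / real n))"
          using av by (intro real_sqrt_le_mono) (simp add: divide_right_mono mult_left_mono mult.left_commute)
        also have "\<dots> = sqrt (2 powr q) * sqrt (real (N l) * v / real n)" by (rule real_sqrt_mult)
        also have "\<dots> \<le> 2 * 2 powr q * sqrt (real (N l) * v / real n)"
        proof (rule mult_right_mono)
          have "sqrt (2 powr q) \<le> 2 powr q" using q1 by (intro real_le_lsqrt) (auto simp: power2_eq_square)
          then show "sqrt (2 powr q) \<le> 2 * 2 powr q" by (rule order_trans) simp
        qed (use v0 in simp)
        finally have "sqrt (real (N l) * a j / real n) \<le> 2 * 2 powr q * sqrt (real (N l) * v / real n)" .
        then show ?thesis using av unfolding e_def by (auto simp: min_def)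
      qed
      have tau_fin: "\<tau> j l = ennreal (3 powr (- p * real l) * e l)" if "l < K" for l
      proof -
        have "Nbar l * ennreal v / ennreal (real n) = ennreal (real (N l) * v / real n)"
          using n v0 by (simp add: Nbar[OF that] ennreal_of_nat_eq_real_of_nat ennreal_mult[symmetric] divide_ennreal)
        then have "(Nbar l * ennreal v / ennreal (real n)) epowr (1 / 2) = ennreal (sqrt (real (N l) * v / real n))"
          using v0 by (simp add: epowr_ennreal powr_half_sqrt)
        moreover have "min (ennreal v) (ennreal (sqrt (real (N l) * v / real n))) = ennreal (e l)"
          unfolding e_def using v0 by (auto simp: min_def ennreal_le_iff)
        ultimately show ?thesis
          unfolding \<tau>_def v_def[symmetric] using e0 by (simp add: ennreal_mult)
      qed
      \<comment> \<open>Positivity of \<open>v\<close> matters: it makes the product with the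
        infinite covering number infinite, so that the minimum is \<open>v\<close>.\<close>
      have tau_inf: "\<tau> j l = ennreal (3 powr (- p * real l) * v)" if "Nbar l = \<infinity>" for l
      proof -
        have "(Nbar l * ennreal v / ennreal (real n)) epowr (1 / 2) = \<infinity>"
          using that v0 n by (simp add: ennreal_top_mult ennreal_top_divide epowr_def)
        then show ?thesis unfolding \<tau>_def v_def[symmetric] using v0 by (simp add: ennreal_mult)
      qed
      define y where "y = 3 powr (- p * real K) * v + (\<Sum>l<K. 3 powr (- p * real l) * e l)"
      have "scale_weight K * (2 * a j) \<le> C * (3 powr (- p * real K) * v)"
        unfolding scale_weight_def C_def using av by (simp add: mult_left_mono algebra_simps)
      moreover have "(\<Sum>l<K. scale_weight l * min (2 * a j) (sqrt (real (N l) * a j / real n)))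
        \<le> (\<Sum>l<K. C * (3 powr (- p * real l) * e l))"
      proof (rule sum_mono)
        fix l
        have "scale_weight l * min (2 * a j) (sqrt (real (N l) * a j / real n)) \<le> scale_weight l * (2 * 2 powr q * e l)"
          by (rule mult_left_mono[OF min_le]) (simp add: scale_weight_def)
        then show "scale_weight l * min (2 * a j) (sqrt (real (N l) * a j / real n)) \<le> C * (3 powr (- p * real l) * e l)"
          unfolding scale_weight_def C_def by (simp add: mult_ac)
      qed
      ultimately have "scale_weight K * (2 * a j) +
        (\<Sum>l<K. scale_weight l * min (2 * a j) (sqrt (real (N l) * a j / real n))) \<le> C * y"
        unfolding y_def by (simp add: distrib_left sum_distrib_left)
      then have "ennreal (scale_weight K * (2 * a j) +
        (\<Sum>l<K. scale_weight l * min (2 * a j) (sqrt (real (N l) * a j / real n)))) \<le> ennreal C * ennreal y"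
        using C0 by (simp add: ennreal_mult'[symmetric] ennreal_leI)
      also have "ennreal y \<le> E j"
      proof -
        have y_eq: "ennreal y = ennreal (3 powr (- p * real K) * v) + (\<Sum>l<K. \<tau> j l)"
        proof -
          have "(\<Sum>l<K. \<tau> j l) = (\<Sum>l<K. ennreal (3 powr (- p * real l) * e l))"
            by (intro sum.cong) (auto simp: tau_fin)
          also have "\<dots> = ennreal (\<Sum>l<K. 3 powr (- p * real l) * e l)" using e0 by (subst sum_ennreal) auto
          finally show ?thesis unfolding y_def using v0 e0 by (simp add: sum_nonneg)
        qed
        show ?thesis
        proof (cases "K = Suc L")
          \<comment> \<open>All levels \<open>0\<close> to \<open>L\<close> are in use, so the
            unresolved mass carries \<open>3 powr (- p * (L + 1))\<close>, slightly better than the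
            claimed exponent.\<close>
          case True
          have "3 powr (- p * real K) * v \<le> 3 powr (- p * real L) * v"
            using True v0 p0 by (intro mult_right_mono powr_mono) auto
          moreover have "{..<K} = {0..L}" using True by auto
          ultimately show ?thesis
            unfolding y_eq E_def v_def[symmetric] by (intro add_mono ennreal_leI) (auto simp: mult.commute)
        next
          case False
          \<comment> \<open>Here \<open>K \<le> L\<close>, so the cost of the unresolved mass is
            itself the summand \<open>l = K\<close> of the claimed bound.\<close>
          then have "Nbar K = \<infinity>" using K by simp
          from tau_inf[OF this] have "ennreal y = (\<Sum>l<Suc K. \<tau> j l)"
            unfolding y_eq by (simp add: add.commute)
          also have "\<dots> \<le> (\<Sum>l=0..L. \<tau> j l)"
            using False K_le by (intro sum_mono2) auto
          also have "\<dots> \<le> E j" unfolding E_def by simp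
          finally show ?thesis .
        qed
      qed
      finally show ?thesis by (simp add: mult_left_mono)
    qed
    have Rp: "R j powr p = m powr p * 2 powr (p * real j)" for j
      unfolding R_def using m by (simp add: powr_mult powr_realpow[symmetric] powr_powr mult.commute)
    have "outer_expectation M (\<lambda>\<omega>. wasserstein p (empirical_measure n (\<lambda>i. X i \<omega>)) \<mu> epowr p)
      \<le> (\<Sum>j. ennreal (R j powr p) * ennreal (scale_weight K * (2 * a j) +
        (\<Sum>l<K. scale_weight l * min (2 * a j) (sqrt (real (N l) * a j / real n)))))"
      unfolding a_def by (rule outer_expectation_wasserstein_le[OF mu(1) M n indep distribution])
    also have "\<dots> \<le> (\<Sum>j. ennreal (wasserstein_const p q) * Mq epowr p * (ennreal (2 powr (p * real j)) * E j))"
    proof (rule suminf_le)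
      fix j
      have "ennreal (R j powr p) * ennreal (scale_weight K * (2 * a j) +
        (\<Sum>l<K. scale_weight l * min (2 * a j) (sqrt (real (N l) * a j / real n))))
        \<le> ennreal (R j powr p) * (ennreal (wasserstein_const p q) * E j)"
        using wasserstein_const_ge[OF p q]
        by (intro mult_left_mono order_trans[OF bound] mult_right_mono ennreal_leI) (auto simp: C_def)
      also have "\<dots> = ennreal (wasserstein_const p q) * Mq epowr p * (ennreal (2 powr (p * real j)) * E j)"
        unfolding Rp Mq epowr_ennreal[OF m0] by (simp add: ennreal_mult mult_ac)
      finally show "ennreal (R j powr p) * ennreal (scale_weight K * (2 * a j) +
        (\<Sum>l<K. scale_weight l * min (2 * a j) (sqrt (real (N l) * a j / real n))))
        \<le> ennreal (wasserstein_const p q) * Mq epowr p * (ennreal (2 powr (p * real j)) * E j)" .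
    qed auto
    also have "\<dots> = ennreal (wasserstein_const p q) * Mq epowr p * (\<Sum>j. ennreal (2 powr (p * real j)) * E j)"
      by (rule ennreal_suminf_cmult)
    finally show ?thesis unfolding E_def \<tau>_def .
  qed
qed

end
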